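(* Let $T$ be the set of triples of distinct elements of $S$, with its equivalence relation $\sim$, let $\mathrm{Cl}(\mathcal R)$ be the set of proper clusters of $\mathcal R$, and let $\mathfrak s_{\max}=\mathcal R$ be the maximal cluster. For an ordered triple $(a,b,c)\in T$ with radius $\mu=v(a-b)$ put $$\Phi((a,b,c)) = D(a,\mu)\cap \mathcal R .$$ Then $\Phi$ gives a well-defined map $\Phi: T/\!\sim\ \to \mathrm{Cl}(\mathcal R)$ (each equivalence class contains an ordered triple, and $\Phi$ takes the same value on equivalent ordered triples). Furthermore: (1) $\Phi: T/\!\sim\ \to \mathrm{Cl}(\mathcal R)$ is injective. (2) $\mathrm{Cl}(\mathcal R)\setminus\{\mathfrak s_{\max}\}\subset \mathrm{Im}(\Phi)$. (3) The cluster $\mathfrak s_{\max}$ lies in the image of $\Phi$ if either one of the following properties holds: (i) $\infty\in S$; (ii) there are three different elements $a,b,c\in\mathcal R$ satisfying $\mu(\mathfrak s_{\max})=v(a-b)=v(b-c)=v(a-c)$ (equivalently, $\mathfrak s_{\max}$ has more than two children).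
   Context: $\mathcal O$ is a complete discrete valuation ring with uniformizer $\pi$, fraction field $K$, residue field $k$ of characteristic $p$, and valuation $v$ with $v(\pi)=1$, extended to an algebraic closure $\overline K$. $n\ge 2$ is an integer with $p\nmid n$, and $K$ contains a primitive $n$-th root of unity. $f(x)\in\mathcal O[x]$ is monic with nonzero discriminant, its set of roots $\mathcal R$ is contained in $K$, and the curve $\mathcal C: y^n=f(x)$ has positive genus. Set $S=\mathcal R\cup\{\infty\}$ if $n\nmid\deg f$, and $S=\mathcal R$ otherwise (one has $|S|\ge 3$). Triples: $T$ is the set of triples of distinct elements of $S$. For $t=(a,b,c)\in T$, $\varphi_t(x)=\frac{(b-c)}{(b-a)}\frac{(x-a)}{(x-c)}$ is the Möbius transformation sending $(a,b,c)$ to $(0,1,\infty)$ (with the usual interpretation if one entry is $\infty$). Two triples are equivalent, $t_1\sim t_2$, if $\varphi_{t_2}\circ\varphi_{t_1}^{-1}$ extends to an automorphism of $\mathbb P^1_{\mathcal O}$, i.e. is given by an element of $\mathrm{PGL}_2(\mathcal O)$. Convention: $v(\infty)=-\infty$, and a difference of a finite element and $\infty$ is $\infty$. An ordered triple is a triple $(a,b,c)\in T$ with $v(a-c)=v(b-c)\le v(a-b)$; its radius is $\mu=v(a-b)$. Clusters: for $z\in\overline K$, $d\in\mathbb Q$ let $D(z,d)=\{x\in\overline K: v(x-z)\ge d\}$. A cluster is a non-empty subset of $\mathcal R$ of the form $D(z,d)\cap\mathcal R$; it is proper if it has more than one element. The diameter of a proper cluster is $\mu(\mathfrak s)=\min\{v(z-t):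 z,t\in\mathfrak s\}$. A child of a cluster $\mathfrak s$ is a maximal cluster (possibly a singleton) strictly contained in $\mathfrak s$. *)

theory Defs
  imports
    "HOL-Library.Extended_Real"
    "HOL-Computational_Algebra.Computational_Algebra"
    "HOL-Algebra.Algebraic_Closure_Type"
    "Subresultants.Resultant_Prelim"
begin

section \<open>Discretely valued fields\<close>

definition valuation :: "('a::field \<Rightarrow> ereal) \<Rightarrow> bool" where
  "valuation v \<longleftrightarrow>
     (\<forall>x. v x \<noteq> -\<infinity>) \<and> (\<forall>x. v x = \<infinity> \<longleftrightarrow> x = 0) \<and>
     (\<forall>x y. v (x * y) = v x + v y) \<and> (\<forall>x y. min (v x) (v y) \<le> v (x + y))"

definition discrete_valuation :: "('a::field \<Rightarrow> ereal) \<Rightarrow> bool" where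
  "discrete_valuation v \<longleftrightarrow>
     valuation v \<and> v ` (UNIV - {0}) = range (\<lambda>m::int. ereal (of_int m))"

definition valuation_ring :: "('a::field \<Rightarrow> ereal) \<Rightarrow> 'a set" where
  "valuation_ring v = {x. 0 \<le> v x}"

definition valuation_complete :: "('a::field \<Rightarrow> ereal) \<Rightarrow> bool" where
  "valuation_complete v \<longleftrightarrow>
     (\<forall>s::nat \<Rightarrow> 'a.
        (\<forall>B::int. \<exists>M. \<forall>i\<ge>M. \<forall>j\<ge>M. ereal (of_int B) \<le> v (s i - s j)) \<longrightarrow>
        (\<exists>L. \<forall>B::int. \<exists>M. \<forall>i\<ge>M. ereal (of_int B) \<le> v (s i - L)))"

text \<open>The image of a natural number \<open>m\<close> in the residue field is zero iff \<open>v m > 0\<close>, so this is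
  the nonnegative generator of the kernel of the map from the integers to the residue field.\<close>

definition residue_char :: "('a::field \<Rightarrow> ereal) \<Rightarrow> nat" where
  "residue_char v = Gcd {m::nat. 0 < v (of_nat m)}"

definition primitive_root_of_unity :: "nat \<Rightarrow> 'a::field \<Rightarrow> bool" where
  "primitive_root_of_unity n z \<longleftrightarrow> z ^ n = 1 \<and> (\<forall>m. 0 < m \<and> m < n \<longrightarrow> z ^ m \<noteq> 1)"

text \<open>The usual formula for the discriminant of a monic polynomial.\<close>

definition monic_discriminant :: "'a::field poly \<Rightarrow> 'a" where
  "monic_discriminant f = (-1) ^ (degree f * (degree f - 1) div 2) * resultant f (pderiv f)"


section \<open>The genus of a superelliptic curve\<close>

text \<open>
  Let \<open>P = Y^n - f(x)\<close>. Elements of \<open>K(x)[Y]/(P)\<close>, the function field of the curve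
  \<open>y^n = f(x)\<close>, are represented by polynomials in \<open>Y\<close> over \<open>K(x)\<close>, two of which are
  identified when their difference is divisible by \<open>P\<close>.
  The normal projective model \<open>C\<close> is the normalisation of the projective line in this field. It is
  covered by the affine curves \<open>x \<noteq> \<infinity>\<close> and \<open>x \<noteq> 0\<close>, whose coordinate rings, like that of
  their intersection, are the integral closures of \<open>K[x]\<close>, \<open>K[1/x]\<close> and \<open>K[x,1/x]\<close>.
  The genus is the \<open>K\<close>-dimension of the first cohomology of the structure sheaf, computed
  as Cech cohomology of this cover. (When \<open>f\<close> is separable and \<open>n\<close> is invertible in \<open>K\<close>,
  \<open>C\<close> is smooth.)
\<close>

definition fun_const :: "'a::field \<Rightarrow> 'a poly fract" where
  "fun_const c = to_fract [:c:]"

definition fun_x :: "'a::field poly fract" where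
  "fun_x = to_fract [:0, 1:]"

text \<open>The subring \<open>K[t]\<close> of \<open>K(x)\<close>, for an element \<open>t\<close> of \<open>K(x)\<close>.\<close>

definition poly_ring_in :: "'a::field poly fract \<Rightarrow> 'a poly fract set" where
  "poly_ring_in t = range (\<lambda>p. poly (map_poly fun_const p) t)"

definition laurent_ring :: "'a::field poly fract set" where
  "laurent_ring = {a * inverse fun_x ^ m | a m. a \<in> poly_ring_in fun_x}"

definition curve_poly :: "nat \<Rightarrow> 'a::field poly \<Rightarrow> 'a poly fract poly" where
  "curve_poly n f = monom 1 n - [:to_fract f:]"

text \<open>The composition of \<open>q\<close> with \<open>u\<close> is the value \<open>q(u)\<close>; divisibility by \<open>P\<close> says that
  it vanishes in \<open>K(x)[Y]/(P)\<close>.\<close>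

definition integral_closure_mod ::
    "'a::field poly fract poly \<Rightarrow> 'a poly fract set \<Rightarrow> 'a poly fract poly set" where
  "integral_closure_mod P A =
     {u. \<exists>q. lead_coeff q = 1 \<and> (\<forall>i. coeff q i \<in> A) \<and> P dvd pcompose q u}"

definition independent_mod ::
    "'a::field poly fract poly set \<Rightarrow> 'a poly fract poly set \<Rightarrow> bool" where
  "independent_mod W U \<longleftrightarrow>
     (\<forall>c :: 'a poly fract poly \<Rightarrow> 'a.
        (\<Sum>u\<in>U. smult (fun_const (c u)) u) \<in> W \<longrightarrow> (\<forall>u\<in>U. c u = 0))"

definition curve_genus :: "nat \<Rightarrow> 'a::field poly \<Rightarrow> enat" where
  "curve_genus n f =
     (let P = curve_poly n f;
          A0 = integral_closure_mod P (poly_ring_in fun_x);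
          A1 = integral_closure_mod P (poly_ring_in (inverse fun_x));
          B = integral_closure_mod P laurent_ring
      in SUP U \<in> {U. finite U \<and> U \<subseteq> B \<and> independent_mod {a0 + a1 | a0 a1. a0 \<in> A0 \<and> a1 \<in> A1} U}.
           enat (card U))"


section \<open>Triples\<close>

text \<open>The projective line over \<open>K\<close>.\<close>

datatype 'a pline = Aff 'a | Infty

definition branch_set :: "nat \<Rightarrow> 'a::field poly \<Rightarrow> 'a pline set" where
  "branch_set n f =
     Aff ` {x. poly f x = 0} \<union> (if n dvd degree f then {} else {Infty})"

type_synonym 'a triple = "'a pline \<times> 'a pline \<times> 'a pline"

definition triples :: "'a pline set \<Rightarrow> 'a triple set" where
  "triples S = {(a, b, c). a \<in> S \<and> b \<in> S \<and> c \<in> S \<and> a \<noteq> b \<and> a \<noteq> c \<and> b \<noteq> c}"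

text \<open>The map \<open>x \<mapsto> (\<alpha> x + \<beta>) / (\<gamma> x + \<delta>)\<close>.\<close>

fun moebius :: "'a::field \<Rightarrow> 'a \<Rightarrow> 'a \<Rightarrow> 'a \<Rightarrow> 'a pline \<Rightarrow> 'a pline" where
  "moebius \<alpha> \<beta> \<gamma> \<delta> (Aff x) =
     (if \<gamma> * x + \<delta> = 0 then Infty else Aff ((\<alpha> * x + \<beta>) / (\<gamma> * x + \<delta>)))"
| "moebius \<alpha> \<beta> \<gamma> \<delta> Infty = (if \<gamma> = 0 then Infty else Aff (\<alpha> / \<gamma>))"

text \<open>The map \<open>x \<mapsto> (b - c) (x - a) / ((b - a) (x - c))\<close>; in the remaining cases the two factors
  that contain the infinite entry cancel. Only triples of distinct points matter.\<close>

fun triple_map :: "'a::field triple \<Rightarrow> 'a pline \<Rightarrow> 'a pline" where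
  "triple_map (Aff a, Aff b, Aff c) = moebius (b - c) (- ((b - c) * a)) (b - a) (- ((b - a) * c))"
| "triple_map (Infty, Aff b, Aff c) = moebius 0 (b - c) 1 (- c)"
| "triple_map (Aff a, Infty, Aff c) = moebius 1 (- a) 1 (- c)"
| "triple_map (Aff a, Aff b, Infty) = moebius 1 (- a) 0 (b - a)"
| "triple_map _ = id"

text \<open>Matrices with entries in the valuation ring and unit determinant.\<close>

definition integral_moebius :: "('a::field \<Rightarrow> ereal) \<Rightarrow> ('a pline \<Rightarrow> 'a pline) \<Rightarrow> bool" where
  "integral_moebius v g \<longleftrightarrow>
     (\<exists>\<alpha> \<in> valuation_ring v. \<exists>\<beta> \<in> valuation_ring v. \<exists>\<gamma> \<in> valuation_ring v. \<exists>\<delta> \<in> valuation_ring v.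
        v (\<alpha> * \<delta> - \<beta> * \<gamma>) = 0 \<and> g = moebius \<alpha> \<beta> \<gamma> \<delta>)"

definition triple_equiv :: "('a::field \<Rightarrow> ereal) \<Rightarrow> 'a pline set \<Rightarrow> ('a triple \<times> 'a triple) set" where
  "triple_equiv v S =
     {(t1, t2). t1 \<in> triples S \<and> t2 \<in> triples S \<and>
        integral_moebius v (triple_map t2 \<circ> inv_into UNIV (triple_map t1))}"

text \<open>The valuation of a difference; the difference of a finite element and \<open>\<infinity>\<close> is \<open>\<infinity>\<close>,
  which has valuation \<open>-\<infinity>\<close>.\<close>

fun vdiff :: "('a::field \<Rightarrow> ereal) \<Rightarrow> 'a pline \<Rightarrow> 'a pline \<Rightarrow> ereal" where
  "vdiff v (Aff x) (Aff y) = v (x - y)"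
| "vdiff v _ _ = -\<infinity>"

fun ordered_triple :: "('a::field \<Rightarrow> ereal) \<Rightarrow> 'a triple \<Rightarrow> bool" where
  "ordered_triple v (a, b, c) \<longleftrightarrow> vdiff v a c = vdiff v b c \<and> vdiff v b c \<le> vdiff v a b"

fun radius :: "('a::field \<Rightarrow> ereal) \<Rightarrow> 'a triple \<Rightarrow> ereal" where
  "radius v (a, b, c) = vdiff v a b"


section \<open>Clusters\<close>

text \<open>Here \<open>w\<close> is a valuation on the algebraic closure. Discs live in the algebraic closure, but
  \<open>R\<close> and its clusters are subsets of the base field.\<close>

definition disc :: "('a::field alg_closure \<Rightarrow> ereal) \<Rightarrow> 'a alg_closure \<Rightarrow> ereal \<Rightarrow> 'a alg_closure set" where
  "disc w z d = {x. d \<le> w (x - z)}"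

definition cluster :: "('a::field alg_closure \<Rightarrow> ereal) \<Rightarrow> 'a set \<Rightarrow> 'a set \<Rightarrow> bool" where
  "cluster w R s \<longleftrightarrow>
     s \<noteq> {} \<and> (\<exists>z. \<exists>d::rat. s = {x \<in> R. to_ac x \<in> disc w z (ereal (of_rat d))})"

definition proper_clusters :: "('a::field alg_closure \<Rightarrow> ereal) \<Rightarrow> 'a set \<Rightarrow> 'a set set" where
  "proper_clusters w R = {s. cluster w R s \<and> 1 < card s}"

definition diameter :: "('a::field \<Rightarrow> ereal) \<Rightarrow> 'a set \<Rightarrow> ereal" where
  "diameter v s = Min {v (z - t) | z t. z \<in> s \<and> t \<in> s}"

definition children :: "('a::field alg_closure \<Rightarrow> ereal) \<Rightarrow> 'a set \<Rightarrow> 'a set \<Rightarrow> 'a set set" where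
  "children w R s =
     {c. cluster w R c \<and> c \<subset> s \<and>
         (\<forall>c'. cluster w R c' \<and> c' \<subset> s \<and> c \<subseteq> c' \<longrightarrow> c' = c)}"


section \<open>The map from triples to clusters\<close>

text \<open>The first entry of an ordered triple is always finite.\<close>

fun triple_cluster ::
    "('a::field \<Rightarrow> ereal) \<Rightarrow> ('a alg_closure \<Rightarrow> ereal) \<Rightarrow> 'a set \<Rightarrow> 'a triple \<Rightarrow> 'a set" where
  "triple_cluster v w R (Aff a, b, c) =
     {x \<in> R. to_ac x \<in> disc w (to_ac a) (radius v (Aff a, b, c))}"
| "triple_cluster v w R (Infty, b, c) = {}"

text \<open>The induced map on equivalence classes, meaningful once all ordered triples in the
  class have the same value.\<close>

definition class_cluster ::
    "('a::field \<Rightarrow> ereal) \<Rightarrow> ('a alg_closure \<Rightarrow> ereal) \<Rightarrow> 'a set \<Rightarrow> 'a triple set \<Rightarrow> 'a set" where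
  "class_cluster v w R C = the_elem (triple_cluster v w R ` {t \<in> C. ordered_triple v t})"

end

theory Submission
  imports Defs "HOL-Number_Theory.Cong" "Jordan_Normal_Form.Char_Poly" "Subresultants.Subresultant_Gcd"
begin

text \<open>
  Up to \<open>PGL\<^sub>2(\<O>)\<close>, the Moebius map of an ordered triple \<open>(a, b, c)\<close> is the affine map
  \<open>x \<mapsto> (x - a) / (b - a)\<close>. Hence two ordered triples \<open>(a, b, c)\<close> and \<open>(a', b', c')\<close> are equivalent iff
  \<open>v (a - b) = v (a' - b') \<le> v (a - a')\<close>, that is, iff the discs \<open>D(a, v (a - b))\<close> and
  \<open>D(a', v (a' - b'))\<close> contain the same roots. Permuting the entries of a triple composes its map with
  an integral transformation permuting \<open>0, 1, \<infinity>\<close>, so every class contains an ordered triple.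

  The genus only matters in order to know that there are at least two roots when \<open>\<infinity> \<in> S\<close>: for
  \<open>f = x - a\<close> the function field is the rational function field in \<open>Y\<close>, with \<open>x = Y^n + a\<close>. A
  function that is integral over \<open>K[x, 1/x]\<close> is a quotient \<open>g(Y) / (Y^n + a)^k\<close>, and division with
  remainder splits it into a polynomial in \<open>Y\<close> and a part that is integral over \<open>K[1/x]\<close>, so that the
  cohomology group vanishes.
\<close>

section \<open>The genus of a curve with linear right-hand side\<close>

lemma fun_const_hom: "inj_comm_ring_hom (fun_const :: 'a::field \<Rightarrow> _)"
  by unfold_locales (auto simp: fun_const_def simp flip: to_fract_add to_fract_mult one_pCons)

interpretation fun_const: inj_comm_ring_hom "fun_const :: 'a::field \<Rightarrow> _"
  by (rule fun_const_hom)

interpretation fun_const_poly: map_poly_inj_comm_ring_hom "fun_const :: 'a::field \<Rightarrow> _" ..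

interpretation to_fract_poly: map_poly_inj_comm_ring_hom "to_fract :: 'a::idom \<Rightarrow> _" ..

lemma map_poly_fun_const_pCons [simp]:
  "map_poly fun_const (pCons c p) = pCons (fun_const c) (map_poly fun_const p)"
  for p :: "'a::field poly"
  by (rule fun_const.map_poly_pCons_hom)

lemma to_fract_conv_poly: "to_fract p = poly (map_poly fun_const p) fun_x" for p :: "'a::field poly"
proof (induction p)
  case (pCons c p)
  have "pCons c p = [:c:] + [:0, 1:] * p"
    by simp
  then have "to_fract (pCons c p) = fun_const c + fun_x * to_fract p"
    unfolding fun_const_def fun_x_def by (metis to_fract_add to_fract_mult)
  with pCons show ?case
    by (simp add: hom_distribs)
qed simp

lemma poly_ring_in_fun_x: "poly_ring_in fun_x = range (to_fract :: 'a::field poly \<Rightarrow> _)"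
  by (simp add: poly_ring_in_def to_fract_conv_poly)

text \<open>The largest exponent required by a coefficient up to the degree serves for all of them;
  beyond the degree the coefficients are 0.\<close>

lemma laurent_ring_common_denominator:
  fixes q :: "'a::field poly fract poly"
  assumes "\<And>i. coeff q i \<in> laurent_ring"
  obtains m p where "\<And>i. coeff q i * fun_x ^ m = to_fract (p i)"
proof -
  have x0: "fun_x \<noteq> (0 :: 'a poly fract)"
    by (simp add: fun_x_def)
  have "\<exists>a m. coeff q i * fun_x ^ m = to_fract a" for i
    using assms[of i] x0 by (auto simp: laurent_ring_def poly_ring_in_fun_x field_simps)
  then obtain a m where am: "\<And>i. coeff q i * fun_x ^ m i = to_fract (a i)"
    by metis
  define M where "M = Max (m ` {..degree q})"
  have "\<exists>b. coeff q i * fun_x ^ M = to_fract b" for i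
  proof (cases "i \<le> degree q")
    case True
    then have "M = m i + (M - m i)"
      by (simp add: M_def)
    then have "coeff q i * fun_x ^ M = to_fract (a i) * fun_x ^ (M - m i)"
      using am[of i] by (metis mult.assoc power_add)
    also have "\<dots> = to_fract (a i * [:0, 1:] ^ (M - m i))"
      by (simp add: fun_x_def to_fract_hom.hom_power)
    finally show ?thesis
      by blast
  next
    case False
    then show ?thesis
      by (auto simp: coeff_eq_0 intro: exI[of _ 0])
  qed
  then show ?thesis
    using that by metis
qed

text \<open>Serves to turn divisibility by the curve polynomial over K(x) into an equation over
  K[x].\<close>

lemma fract_poly_common_denominator:
  fixes z :: "'a::idom fract poly"
  obtains d q where "d \<noteq> 0" "smult (to_fract d) z = map_poly to_fract q"
proof -
  have "\<exists>d q. d \<noteq> 0 \<and> smult (to_fract d) z = map_poly to_fract q"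
  proof (induction z)
    case (pCons c z)
    then obtain d q where dq: "d \<noteq> 0" "smult (to_fract d) z = map_poly to_fract q"
      by blast
    obtain a b where ab: "c = to_fract a / to_fract b" "b \<noteq> 0"
      by (cases c) (auto simp: Fract_conv_to_fract)
    have "smult (to_fract (b * d)) (pCons c z) = 
      pCons (to_fract (b * d) * c) (smult (to_fract b) (smult (to_fract d) z))"
      by (simp add: hom_distribs)
    also have "\<dots> = map_poly to_fract (pCons (a * d) (smult b q))"
      unfolding dq by (simp add: ab hom_distribs)
    finally show ?case
      using ab(2) dq(1) by (metis mult_eq_0_iff)
  qed (auto intro: exI[of _ 1] exI[of _ 0])
  then show ?thesis
    using that by blast
qed

text \<open>A divisor of least positive degree is irreducible, and irreducible polynomials over a
  field are prime.\<close>

lemma prime_elem_factor_exists: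
  fixes h :: "'a::field poly"
  assumes "degree h > 0"
  obtains r where "prime_elem r" "r dvd h"
proof -
  define Q where "Q r \<longleftrightarrow> r dvd h \<and> degree r > 0" for r
  define r where "r = arg_min degree Q"
  have "Q h"
    using assms by (simp add: Q_def)
  then have r: "Q r" "\<And>s. Q s \<Longrightarrow> degree r \<le> degree s"
    unfolding r_def by (metis arg_min_natI, metis arg_min_nat_le)
  have "irreducible r"
  proof (rule irreducibleI)
    show "r \<noteq> 0" "\<not> r dvd 1"
      using r(1) by (auto simp: Q_def is_unit_iff_degree)
  next
    fix a b assume ab: "r = a * b"
    with r(1) have nz: "a \<noteq> 0" "b \<noteq> 0"
      by (auto simp: Q_def)
    show "a dvd 1 \<or> b dvd 1"
    proof (rule ccontr)
      assume "\<not> ?thesis"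
      then have "degree a > 0" "degree b > 0"
        using nz by (auto simp: is_unit_iff_degree)
      moreover from this have "Q a"
        using r(1) ab by (auto simp: Q_def intro: dvd_mult_left)
      ultimately show False
        using r(2)[of a] nz by (simp add: ab degree_mult_eq)
    qed
  qed
  then show ?thesis
    using that r(1) field_poly_irreducible_imp_prime by (auto simp: Q_def)
qed

text \<open>A matrix over K[t] can thus be lifted to a matrix of polynomials over K, and its
  characteristic polynomial is the image of the lifted one. This keeps the coefficients in
  K[t].\<close>

lemma eval_fun_const_hom: "comm_ring_hom (\<lambda>p. poly (map_poly fun_const p) t)"
  for t :: "'a::field poly fract"
  by unfold_locales (simp_all only: fun_const_poly.hom_zero fun_const_poly.hom_one
      fun_const_poly.hom_add fun_const_poly.hom_mult poly_0 poly_1 poly_add poly_mult)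

text \<open>The span of the \<open>e j\<close> contains 1, so the characteristic polynomial of a matrix of \<open>u\<close> on it
  annihilates \<open>u\<close> modulo \<open>P\<close>.\<close>

lemma in_integral_closure_mod_if_stable:
  fixes P u :: "'a::field poly fract poly" and e :: "nat \<Rightarrow> 'a poly fract poly"
  assumes e0: "e 0 = 1" and n: "n > 0"
    and stable: "\<And>i. i < n \<Longrightarrow>
      \<exists>c. [u * e i = (\<Sum>j<n. smult (poly (map_poly fun_const (c j)) t) (e j))] (mod P)"
  shows "u \<in> integral_closure_mod P (poly_ring_in t)"
proof -
  define h where "h = (\<lambda>p::'a poly. poly (map_poly fun_const p) t)"
  interpret h: comm_ring_hom h
    unfolding h_def by (rule eval_fun_const_hom)
  define c where "c i = (SOME c. [u * e i = (\<Sum>j<n. smult (h (c j)) (e j))] (mod P))" for i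
  have c: "[u * e i = (\<Sum>j<n. smult (h (c i j)) (e j))] (mod P)" if "i < n" for i
    unfolding c_def h_def by (rule someI_ex[OF stable[OF that]])
  define A where "A = mat n n (\<lambda>(i, j). c i j)"
  define hA where "hA = map_mat h A"
  define q where "q = char_poly hA"
  have A: "A \<in> carrier_mat n n" and hA: "hA \<in> carrier_mat n n"
    by (auto simp: A_def hA_def)
  have q: "q = map_poly h (char_poly A)"
    unfolding q_def hA_def using A by (rule h.char_poly_hom)
  have lead: "lead_coeff q = 1"
    using degree_monic_char_poly[OF hA] by (simp add: q_def)
  \<comment> \<open>Substituting \<open>u\<close> for the variable of the characteristic matrix
    gives \<open>u\<close> times the identity minus \<open>hA\<close>, with determinant
    \<open>pcompose q u\<close>.\<close>
  define B where "B = map_mat (\<lambda>q. pcompose q u) (char_poly_matrix hA)"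
  have B: "B \<in> carrier_mat n n"
    using hA by (simp add: B_def)
  have B_index: "B $$ (i, j) = (if i = j then u else 0) - [:h (c i j):]" if "i < n" "j < n" for i j
    using that hA by (simp add: B_def char_poly_matrix_def hA_def A_def pcompose_pCons pcompose_add)
  have detB: "det B = pcompose q u"
    unfolding B_def q_def char_poly_def by (rule comm_ring_hom.hom_det[OF pcompose_hom.comm_ring_hom_axioms])
  have Be: "P dvd (\<Sum>j<n. B $$ (i, j) * e j)" if "i < n" for i
  proof -
    have "(\<Sum>j<n. B $$ (i, j) * e j) = u * e i - (\<Sum>j<n. smult (h (c i j)) (e j))"
    proof -
      have "(\<Sum>j<n. B $$ (i, j) * e j) =
          (\<Sum>j<n. (if i = j then u * e j else 0) - smult (h (c i j)) (e j))"
        using that by (intro sum.cong) (auto simp: B_index algebra_simps)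
      also have "\<dots> = u * e i - (\<Sum>j<n. smult (h (c i j)) (e j))"
        using that by (simp add: sum_subtractf)
      finally show ?thesis .
    qed
    then show ?thesis
      using c[OF that] by (simp add: cong_iff_dvd_diff)
  qed
  \<comment> \<open>Cramer's rule: \<open>adj_mat B * B\<close> is \<open>det B\<close> times the
    identity, and \<open>e 0 = 1\<close>. Regrouping the double sum exhibits \<open>det B\<close> as
    a combination of the rows of \<open>B\<close> applied to \<open>e\<close>, all of which are
    divisible by \<open>P\<close>.\<close>
  have "det B = (\<Sum>j<n. (adj_mat B * B) $$ (0, j) * e j)"
  proof -
    have "(\<Sum>j<n. (adj_mat B * B) $$ (0, j) * e j) = (\<Sum>j<n. if j = 0 then det B * e j else 0)"
      unfolding adj_mat(3)[OF B] using n by (intro sum.cong) auto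
    also have "\<dots> = det B"
      using n e0 by simp
    finally show ?thesis ..
  qed
  also have "\<dots> = (\<Sum>j<n. \<Sum>i<n. adj_mat B $$ (0, i) * B $$ (i, j) * e j)"
    using adj_mat(1)[OF B] B n 
    by (intro sum.cong refl) (simp add: scalar_prod_def sum_distrib_right lessThan_atLeast0)
  also have "\<dots> = (\<Sum>i<n. adj_mat B $$ (0, i) * (\<Sum>j<n. B $$ (i, j) * e j))"
    by (subst sum.swap) (simp add: sum_distrib_left mult.assoc)
  also have "P dvd \<dots>"
    by (intro dvd_sum dvd_mult Be) simp
  finally have "P dvd pcompose q u"
    by (simp add: detB)
  moreover have "coeff q i \<in> poly_ring_in t" for i
  proof -
    have "coeff q i = h (coeff (char_poly A) i)"
      by (simp add: q)
    then show ?thesis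
      by (simp add: poly_ring_in_def h_def)
  qed
  ultimately show ?thesis
    using lead unfolding integral_closure_mod_def by blast
qed

lemma to_fract_pCons: "to_fract (pCons c p) = fun_const c + fun_x * to_fract p"
  for p :: "'a::field poly"
  by (simp add: to_fract_conv_poly)

section \<open>The function field of y^n = x - a as the rational function field in Y\<close>

locale line_cover =
  fixes n :: nat and a :: "'a::field"
  assumes n_pos: "n > 0"
begin

text \<open>The coordinate x on the curve, expressed through Y.\<close>

definition D :: "'a poly" where "D = monom 1 n + [:a:]"

definition P :: "'a poly fract poly" where "P = curve_poly n [:- a, 1:]"

abbreviation \<kappa> :: "'a poly \<Rightarrow> 'a poly fract poly" where "\<kappa> \<equiv> map_poly fun_const"

lemma degree_D: "degree D = n"
  unfolding D_def using n_pos by (subst degree_add_eq_left) (auto simp: degree_monom_eq)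

lemma D_nonzero: "D \<noteq> 0"
  using degree_D n_pos by auto

lemma pcompose_D_eq_0_iff: "pcompose d D = 0 \<longleftrightarrow> d = 0"
  using n_pos degree_D by (auto simp: pcompose_eq_0)

lemma P_eq: "P = \<kappa> D - [:fun_x:]"
proof -
  have "to_fract [:- a, 1:] = fun_x - fun_const a"
    by (simp add: fun_x_def fun_const_def flip: to_fract_diff)
  then show ?thesis
    by (simp add: P_def curve_poly_def D_def fun_const.map_poly_hom_add map_poly_monom map_poly_pCons)
qed

lemma cong_fun_x: "[\<kappa> D = [:fun_x:]] (mod P)"
  by (simp add: cong_iff_dvd_diff P_eq)

text \<open>Horner's scheme, with x replaced by \<open>D\<close> at each step by means of
  \<open>cong_fun_x\<close>.\<close>

lemma cong_to_fract: "[[:to_fract p:] = \<kappa> (pcompose p D)] (mod P)"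
proof (induction p)
  case (pCons c p)
  have "[:to_fract (pCons c p):] = [:fun_const c:] + [:fun_x:] * [:to_fract p:]"
    by (simp add: to_fract_pCons)
  also have "[[:fun_const c:] + [:fun_x:] * [:to_fract p:] = [:fun_const c:] + \<kappa> D * \<kappa> (pcompose p D)] (mod P)"
    by (rule cong_add[OF cong_refl cong_mult[OF cong_sym[OF cong_fun_x] pCons.IH]])
  also have "[:fun_const c:] + \<kappa> D * \<kappa> (pcompose p D) = \<kappa> (pcompose (pCons c p) D)"
    by (simp add: pcompose_pCons fun_const_poly.hom_add fun_const_poly.hom_mult)
  finally show ?case .
qed simp

text \<open>Clearing the denominators of the coefficients leaves a polynomial in x and Y, in which x
  is replaced by \<open>D\<close>. Every function is therefore a quotient of an element of K[Y] by
  one of K[x].\<close>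

lemma common_denominator:
  fixes z :: "'a poly fract poly"
  obtains d g where "d \<noteq> 0" "[[:to_fract d:] * z = \<kappa> g] (mod P)"
proof -
  have "\<exists>d g. d \<noteq> 0 \<and> [[:to_fract d:] * z = \<kappa> g] (mod P)"
  proof (induction z)
    case 0
    show ?case
      by (intro exI[of _ 1] exI[of _ 0]) simp
  next
    case (pCons c z)
    then obtain d g where dg: "d \<noteq> 0" "[[:to_fract d:] * z = \<kappa> g] (mod P)"
      by blast
    obtain p q where pq: "c = to_fract p / to_fract q" "q \<noteq> 0"
      by (cases c) (auto simp: Fract_conv_to_fract)
    have "[:to_fract (q * d):] * pCons c z =
        [:to_fract (p * d):] + [:to_fract q:] * ([:0, 1:] * ([:to_fract d:] * z))"
      using pq by (simp add: mult.commute)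
    also have "[\<dots> = \<kappa> (pcompose (p * d) D) + \<kappa> (pcompose q D) * ([:0, 1:] * \<kappa> g)] (mod P)"
      by (rule cong_add[OF cong_to_fract cong_mult[OF cong_to_fract cong_scalar_left[OF dg(2)]]])
    also have "\<kappa> (pcompose (p * d) D) + \<kappa> (pcompose q D) * ([:0, 1:] * \<kappa> g) =
        \<kappa> (pcompose (p * d) D + pcompose q D * ([:0, 1:] * g))"
      by (simp add: fun_const_poly.hom_add fun_const_poly.hom_mult)
    finally show ?case
      using dg(1) pq(2) by (metis mult_eq_0_iff)
  qed
  then show ?thesis
    using that by blast
qed

text \<open>Clear denominators in a multiple of \<open>P\<close> and substitute \<open>Y^n + a\<close> for \<open>x\<close>.\<close>

lemma P_dvd_imp_zero:
  assumes "P dvd \<kappa> g"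
  shows "g = 0"
proof -
  obtain Q where Q: "\<kappa> g = P * Q"
    using assms by blast
  obtain d Q' where d: "d \<noteq> 0" "smult (to_fract d) Q = map_poly to_fract Q'"
    by (rule fract_poly_common_denominator)
  define P' where "P' = monom 1 n - [:[:- a, 1:] :: 'a poly:]"
  define g' where "g' = map_poly (\<lambda>c. [:c:]) g"
  have P: "P = map_poly to_fract P'"
    by (simp add: P_def P'_def curve_poly_def to_fract_poly.hom_minus map_poly_monom)
  have g: "\<kappa> g = map_poly to_fract g'"
    unfolding g'_def by (subst map_poly_map_poly) (auto simp: fun_const_def[abs_def] comp_def)
  have "map_poly to_fract (smult d g') = smult (to_fract d) (\<kappa> g)"
    by (simp add: g)
  also have "\<dots> = map_poly to_fract (P' * Q')"
    by (simp add: Q P to_fract_poly.hom_mult flip: d(2))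
  finally have eq: "smult d g' = P' * Q'"
    by (rule to_fract_poly.injectivity)
  \<comment> \<open>The argument is a polynomial in Y over K[x]. The coefficients are composed with
    \<open>D\<close> and the outer variable is evaluated at Y, so everything lands in K[Y];
    \<open>P'\<close> is sent to 0 and \<open>g'\<close> to \<open>g\<close>.\<close>
  define ev where "ev q = poly (map_poly (\<lambda>c. pcompose c D) q) [:0, 1:]" for q
  interpret sub: map_poly_comm_ring_hom "\<lambda>c. pcompose c D" ..
  have ev_mult: "ev (p * q) = ev p * ev q" for p q
    by (simp add: ev_def sub.hom_mult)
  have "map_poly (\<lambda>c. pcompose c D) P' = monom 1 n - [:D - [:a:]:]"
    by (simp add: P'_def sub.hom_minus map_poly_monom pcompose_1 pcompose_pCons
        pcompose_hom.map_poly_pCons_hom)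
  then have "ev P' = 0"
    by (simp add: ev_def poly_monom D_def monom_altdef)
  moreover have "ev g' = poly (map_poly (\<lambda>c. [:c:]) g) [:0, 1:]"
    unfolding g'_def ev_def by (subst map_poly_map_poly) (simp_all add: comp_def)
  then have "ev g' = g"
    by (metis pcompose_altdef pcompose_idR)
  moreover have "ev [:d:] = pcompose d D"
    by (simp add: ev_def pcompose_hom.map_poly_pCons_hom)
  ultimately have "pcompose d D * g = 0"
    using arg_cong[OF eq, of ev] ev_mult[of "[:d:]" g'] ev_mult[of P' Q'] by simp
  then show ?thesis
    using d(1) pcompose_D_eq_0_iff by auto
qed

text \<open>K[Y] embeds into the function field, so congruences between its elements become
  equations, to which divisibility in K[Y] applies.\<close>

lemma kappa_cong_iff: "[\<kappa> g = \<kappa> h] (mod P) \<longleftrightarrow> g = h"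
proof
  assume "[\<kappa> g = \<kappa> h] (mod P)"
  then have "P dvd \<kappa> (g - h)"
    by (simp add: cong_iff_dvd_diff fun_const_poly.hom_minus)
  then show "g = h"
    using P_dvd_imp_zero by fastforce
qed simp

lemma cong_const_cancel:
  assumes "[[:c:] * z = [:c:] * z'] (mod P)" "c \<noteq> 0"
  shows "[z = z'] (mod P)"
proof -
  have "[[:1 / c:] * ([:c:] * z) = [:1 / c:] * ([:c:] * z')] (mod P)"
    by (rule cong_scalar_left[OF assms(1)])
  then show ?thesis
    using assms(2) by simp
qed

text \<open>Nonzero elements of K[Y] are not zero divisors modulo \<open>P\<close>: clearing the
  denominator of a \<open>w\<close> that they annihilate moves the relation into the integral domain
  K[Y].\<close>

lemma cong_kappa_cancel:
  assumes "[\<kappa> r * z = \<kappa> r * z'] (mod P)" "r \<noteq> 0"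
  shows "[z = z'] (mod P)"
proof -
  have cancel0: "[w = 0] (mod P)" if w: "[\<kappa> r * w = 0] (mod P)" for w
  proof -
    obtain d g where dg: "d \<noteq> 0" "[[:to_fract d:] * w = \<kappa> g] (mod P)"
      by (rule common_denominator)
    have "[\<kappa> (r * g) = \<kappa> r * ([:to_fract d:] * w)] (mod P)"
      using cong_sym[OF dg(2)] by (simp only: fun_const_poly.hom_mult cong_scalar_left)
    also have "\<kappa> r * ([:to_fract d:] * w) = [:to_fract d:] * (\<kappa> r * w)"
      by simp
    also have "[\<dots> = [:to_fract d:] * 0] (mod P)"
      by (rule cong_scalar_left[OF w])
    finally have "[\<kappa> (r * g) = \<kappa> 0] (mod P)"
      by simp
    then have "g = 0"
      unfolding kappa_cong_iff using assms(2) by simp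
    then have "[[:to_fract d:] * w = [:to_fract d:] * 0] (mod P)"
      using dg(2) by simp
    then show ?thesis
      by (rule cong_const_cancel) (use dg(1) in simp)
  qed
  have "[\<kappa> r * (z - z') = 0] (mod P)"
    using assms(1) by (simp add: cong_iff_dvd_diff algebra_simps)
  then have "[z - z' = 0] (mod P)"
    by (rule cancel0)
  then show ?thesis
    by (simp add: cong_iff_dvd_diff)
qed

end

lemma pcompose_conv_sum: "pcompose q u = (\<Sum>i\<le>degree q. [:coeff q i:] * u ^ i)"
proof -
  have "degree (map_poly (\<lambda>x. [:x:]) q) = degree q"
    by (rule degree_map_poly) auto
  then show ?thesis
    by (simp add: pcompose_altdef poly_altdef coeff_map_poly)
qed

lemma integral_closure_mod_cong:
  fixes P :: "'a::field poly fract poly"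
  assumes "[u = u'] (mod P)" "u' \<in> integral_closure_mod P A"
  shows "u \<in> integral_closure_mod P A"
proof -
  have "[pcompose q u = pcompose q u'] (mod P)" for q
    unfolding pcompose_conv_sum by (intro cong_sum cong_scalar_left cong_pow assms(1))
  then show ?thesis
    using assms(2) cong_dvd_iff unfolding integral_closure_mod_def by blast
qed

context line_cover
begin

text \<open>The argument of the rational root theorem. Multiplied by \<open>x^m * H^N\<close>, the
  integral equation for \<open>u = g / H\<close> becomes an equation in K[Y]; its terms of index
  below \<open>N\<close> contain the factor \<open>H\<close>, and its leading term is
  \<open>D ^ m * g ^ N\<close> because \<open>q\<close> is monic.\<close>

lemma denominator_dvd:
  assumes q: "P dvd pcompose q u" "lead_coeff q = 1"
    and p: "\<And>i. coeff q i * fun_x ^ m = to_fract (p i)"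
    and H: "[\<kappa> H * u = \<kappa> g] (mod P)"
  shows "H dvd D ^ m * g ^ degree q"
proof -
  define N where "N = degree q"
  define F where "F i = pcompose (p i) D * (H ^ (N - i) * g ^ i)" for i
  have term_cong: "[[:fun_x ^ m:] * \<kappa> H ^ N * ([:coeff q i:] * u ^ i) = \<kappa> (F i)] (mod P)"
    if "i \<le> N" for i
  proof -
    have "\<kappa> H ^ N = \<kappa> H ^ (N - i) * \<kappa> H ^ i"
      using that by (simp flip: power_add)
    then have "[:fun_x ^ m:] * \<kappa> H ^ N * ([:coeff q i:] * u ^ i) =
        ([:coeff q i:] * [:fun_x ^ m:]) * (\<kappa> H ^ (N - i) * (\<kappa> H * u) ^ i)"
      by (simp only: power_mult_distrib mult_ac)
    also have "[:coeff q i:] * [:fun_x ^ m:] = [:to_fract (p i):]"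
      using p[of i] by (simp add: mult.commute)
    also have "[[:to_fract (p i):] * (\<kappa> H ^ (N - i) * (\<kappa> H * u) ^ i) =
        \<kappa> (pcompose (p i) D) * (\<kappa> H ^ (N - i) * \<kappa> g ^ i)] (mod P)"
      by (rule cong_mult[OF cong_to_fract cong_scalar_left[OF cong_pow[OF H]]])
    finally show ?thesis
      by (simp only: F_def fun_const_poly.hom_mult fun_const_poly.hom_power)
  qed
  have "[\<kappa> (\<Sum>i\<le>N. F i) = [:fun_x ^ m:] * \<kappa> H ^ N * pcompose q u] (mod P)"
    unfolding pcompose_conv_sum fun_const_poly.hom_sum sum_distrib_left N_def[symmetric]
    by (rule cong_sum, rule cong_sym, rule term_cong) simp
  also have "[[:fun_x ^ m:] * \<kappa> H ^ N * pcompose q u = \<kappa> 0] (mod P)"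
    unfolding fun_const_poly.hom_zero cong_0_iff using q(1) by (rule dvd_mult)
  finally have sum0: "(\<Sum>i\<le>N. F i) = 0"
    unfolding kappa_cong_iff .
  have "to_fract (p N) = fun_x ^ m"
    using p[of N] q(2) by (simp add: N_def)
  also have "\<dots> = to_fract ([:0, 1:] ^ m)"
    by (simp add: fun_x_def to_fract_hom.hom_power)
  finally have "p N = [:0, 1:] ^ m"
    unfolding to_fract_eq_iff .
  then have "F N = D ^ m * g ^ N"
    by (simp add: F_def pcompose_hom.hom_power pcompose_pCons)
  with sum0 have "D ^ m * g ^ N = - (\<Sum>i<N. F i)"
    by (simp add: lessThan_Suc_atMost[symmetric] eq_neg_iff_add_eq_0 add.commute)
  moreover have "H dvd F i" if "i < N" for i
    using that by (auto simp: F_def intro!: dvd_mult dvd_mult2 dvd_power)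
  ultimately show ?thesis
    by (auto simp: N_def intro!: dvd_sum)
qed

text \<open>A prime factor of the denominator that does not divide \<open>Y^n + a\<close> cancels.\<close>

lemma integral_imp_denominator_power:
  assumes "u \<in> integral_closure_mod P laurent_ring"
  obtains k g where "[\<kappa> (D ^ k) * u = \<kappa> g] (mod P)"
proof -
  obtain q where q: "lead_coeff q = 1" "\<And>i. coeff q i \<in> laurent_ring" "P dvd pcompose q u"
    using assms by (auto simp: integral_closure_mod_def)
  obtain m p where p: "\<And>i. coeff q i * fun_x ^ m = to_fract (p i)"
    using laurent_ring_common_denominator[OF q(2)] by metis
  \<comment> \<open>Here \<open>h\<close> is the part of the denominator not yet known to be a power
    of \<open>D\<close>. Each step removes one prime factor from it, until it is constant and can be
    inverted.\<close>
  have reduce: "\<exists>k g. [\<kappa> (D ^ k) * u = \<kappa> g] (mod P)"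
    if "h \<noteq> 0" "[\<kappa> (h * D ^ k) * u = \<kappa> g] (mod P)" for h k g
    using that
  proof (induction "degree h" arbitrary: h k g rule: less_induct)
    case less
    show ?case
    proof (cases "degree h = 0")
      case True
      then obtain c where c: "h = [:c:]" "c \<noteq> 0"
        using less.prems(1) by (metis degree_eq_zeroE pCons_0_0)
      have "[\<kappa> [:1 / c:] * (\<kappa> (h * D ^ k) * u) = \<kappa> [:1 / c:] * \<kappa> g] (mod P)"
        by (rule cong_scalar_left[OF less.prems(2)])
      also have "\<kappa> [:1 / c:] * (\<kappa> (h * D ^ k) * u) = \<kappa> ([:1 / c:] * (h * D ^ k)) * u"
        by (simp only: fun_const_poly.hom_mult mult.assoc)
      also have "[:1 / c:] * (h * D ^ k) = D ^ k"
        using c by simp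
      finally show ?thesis
        by (metis fun_const_poly.hom_mult)
    next
      case False
      then obtain r where r: "prime_elem r" "r dvd h"
        using prime_elem_factor_exists[of h] by auto
      then obtain h1 where h1: "h = r * h1"
        by blast
      have nz: "r \<noteq> 0" "h1 \<noteq> 0"
        using less.prems(1) h1 by auto
      have "degree r > 0"
        using r(1) nz by (auto simp: prime_elem_def is_unit_iff_degree)
      then have smaller: "degree h1 < degree h"
        using nz by (simp add: h1 degree_mult_eq)
      \<comment> \<open>If \<open>r\<close> divides \<open>D\<close>, multiplying by the cofactor
        \<open>r1\<close> turns \<open>r\<close> into one more factor \<open>D\<close>. Otherwise
        \<open>r\<close> divides \<open>g\<close> by \<open>denominator_dvd\<close> and is cancelled
        on both sides.\<close>
      show ?thesis
      proof (cases "r dvd D")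
        case True
        then obtain r1 where r1: "D = r * r1"
          by blast
        have "[\<kappa> r1 * (\<kappa> (h * D ^ k) * u) = \<kappa> r1 * \<kappa> g] (mod P)"
          by (rule cong_scalar_left[OF less.prems(2)])
        also have "\<kappa> r1 * (\<kappa> (h * D ^ k) * u) = \<kappa> (r1 * (h * D ^ k)) * u"
          by (simp only: fun_const_poly.hom_mult mult.assoc)
        also have "r1 * (h * D ^ k) = h1 * D ^ Suc k"
          by (simp add: h1 r1 mult_ac)
        finally have "[\<kappa> (h1 * D ^ Suc k) * u = \<kappa> (r1 * g)] (mod P)"
          by (simp only: fun_const_poly.hom_mult)
        then show ?thesis
          by (rule less.hyps[OF smaller nz(2)])
      next
        case False
        have "h * D ^ k dvd D ^ m * g ^ degree q"
          by (rule denominator_dvd[OF q(3) q(1) p less.prems(2)])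
        then have "r dvd D ^ m * g ^ degree q"
          using r(2) by (metis dvd_mult_left dvd_trans)
        then have "r dvd g"
          using r(1) False by (metis prime_elem_dvd_mult_iff prime_elem_dvd_power)
        then obtain g1 where g1: "g = r * g1"
          by blast
        have "\<kappa> r * (\<kappa> (h1 * D ^ k) * u) = \<kappa> (h * D ^ k) * u"
          by (simp only: h1 fun_const_poly.hom_mult mult.assoc)
        then have "[\<kappa> r * (\<kappa> (h1 * D ^ k) * u) = \<kappa> r * \<kappa> g1] (mod P)"
          using less.prems(2) by (simp only: g1 fun_const_poly.hom_mult)
        then have "[\<kappa> (h1 * D ^ k) * u = \<kappa> g1] (mod P)"
          using nz(1) by (rule cong_kappa_cancel)
        then show ?thesis
          by (rule less.hyps[OF smaller nz(2)])
      qed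
    qed
  qed
  obtain d g where d: "d \<noteq> 0" "[[:to_fract d:] * u = \<kappa> g] (mod P)"
    by (rule common_denominator)
  \<comment> \<open>The reduction starts from the denominator \<open>d\<close> in K[x], rewritten in
    Y, and from exponent 0.\<close>
  have "[\<kappa> (pcompose d D * D ^ 0) * u = [:to_fract d:] * u] (mod P)"
    unfolding power_0 mult_1_right by (rule cong_scalar_right[OF cong_sym[OF cong_to_fract]])
  also note d(2)
  finally show ?thesis
    using reduce that d(1) pcompose_D_eq_0_iff by metis
qed

section \<open>Finitely generated K[t]-modules and their multipliers\<close>

definition span :: "'a poly fract \<Rightarrow> (nat \<Rightarrow> 'a poly fract poly) \<Rightarrow> 'a poly fract poly set" where
  "span t e = {z. \<exists>c. [z = (\<Sum>j<n. smult (poly (\<kappa> (c j)) t) (e j))] (mod P)}"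

text \<open>Tested on generators only; \<open>stable_span\<close> extends it to the whole module.
  Stable elements are then closed under sums, products and multiplication by K[t], so it suffices to
  find a few of them.\<close>

definition stable :: "'a poly fract \<Rightarrow> (nat \<Rightarrow> 'a poly fract poly) \<Rightarrow> 'a poly fract poly \<Rightarrow> bool" where
  "stable t e u \<longleftrightarrow> (\<forall>j<n. u * e j \<in> span t e)"

lemma span_cong: "[z = z'] (mod P) \<Longrightarrow> z' \<in> span t e \<Longrightarrow> z \<in> span t e"
  unfolding span_def using cong_trans by blast

lemma span_0: "0 \<in> span t e"
  unfolding span_def by (auto intro!: exI[of _ "\<lambda>_. 0"])

lemma span_add:
  assumes "z \<in> span t e" "z' \<in> span t e"
  shows "z + z' \<in> span t e"
proof -
  obtain c c' where "[z = (\<Sum>j<n. smult (poly (\<kappa> (c j)) t) (e j))] (mod P)"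
      "[z' = (\<Sum>j<n. smult (poly (\<kappa> (c' j)) t) (e j))] (mod P)"
    using assms unfolding span_def by blast
  then have "[z + z' = (\<Sum>j<n. smult (poly (\<kappa> (c j)) t) (e j)) +
      (\<Sum>j<n. smult (poly (\<kappa> (c' j)) t) (e j))] (mod P)"
    by (rule cong_add)
  also have "(\<Sum>j<n. smult (poly (\<kappa> (c j)) t) (e j)) + (\<Sum>j<n. smult (poly (\<kappa> (c' j)) t) (e j)) =
      (\<Sum>j<n. smult (poly (\<kappa> (c j + c' j)) t) (e j))"
    by (simp only: fun_const_poly.hom_add poly_add smult_add_left sum.distrib)
  finally show ?thesis
    unfolding span_def mem_Collect_eq by (rule exI[of _ "\<lambda>j. c j + c' j"])
qed

lemma span_smult:
  assumes "z \<in> span t e"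
  shows "smult (poly (\<kappa> p) t) z \<in> span t e"
proof -
  obtain c where "[z = (\<Sum>j<n. smult (poly (\<kappa> (c j)) t) (e j))] (mod P)"
    using assms unfolding span_def by blast
  then have "[[:poly (\<kappa> p) t:] * z =
      [:poly (\<kappa> p) t:] * (\<Sum>j<n. smult (poly (\<kappa> (c j)) t) (e j))] (mod P)"
    by (rule cong_scalar_left)
  also have "[:poly (\<kappa> p) t:] * z = smult (poly (\<kappa> p) t) z"
    by simp
  also have "[:poly (\<kappa> p) t:] * (\<Sum>j<n. smult (poly (\<kappa> (c j)) t) (e j)) =
      (\<Sum>j<n. smult (poly (\<kappa> (p * c j)) t) (e j))"
    by (simp add: fun_const_poly.hom_mult smult_sum2)
  finally show ?thesis
    unfolding span_def mem_Collect_eq by (rule exI[of _ "\<lambda>j. p * c j"])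
qed

lemma span_base:
  assumes "j < n"
  shows "e j \<in> span t e"
proof -
  have "(\<Sum>i<n. smult (poly (\<kappa> (if i = j then 1 else 0)) t) (e i)) =
      (\<Sum>i<n. if i = j then e i else 0)"
    by (intro sum.cong) auto
  also have "\<dots> = e j"
    using assms by simp
  finally show ?thesis
    unfolding span_def mem_Collect_eq
    by (intro exI[of _ "\<lambda>i. if i = j then 1 else 0"]) (simp only: cong_refl)
qed

lemma span_sum: "(\<And>i. i \<in> A \<Longrightarrow> f i \<in> span t e) \<Longrightarrow> sum f A \<in> span t e"
  by (induction A rule: infinite_finite_induct) (auto intro: span_add span_0)

lemma stable_span:
  assumes "stable t e u" "z \<in> span t e"
  shows "u * z \<in> span t e"
proof -
  obtain c where c: "[z = (\<Sum>j<n. smult (poly (\<kappa> (c j)) t) (e j))] (mod P)"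
    using assms(2) unfolding span_def by blast
  have "(\<Sum>j<n. smult (poly (\<kappa> (c j)) t) (u * e j)) \<in> span t e"
    using assms(1) by (intro span_sum span_smult) (auto simp: stable_def)
  also have "(\<Sum>j<n. smult (poly (\<kappa> (c j)) t) (u * e j)) =
      u * (\<Sum>j<n. smult (poly (\<kappa> (c j)) t) (e j))"
    by (simp add: sum_distrib_left)
  finally show ?thesis
    by (rule span_cong[OF cong_scalar_left[OF c]])
qed

lemma stable_mult: "stable t e u \<Longrightarrow> stable t e u' \<Longrightarrow> stable t e (u * u')"
  unfolding stable_def using stable_span[unfolded stable_def] by (simp add: mult.assoc)

lemma stable_add: "stable t e u \<Longrightarrow> stable t e u' \<Longrightarrow> stable t e (u + u')"
  by (simp add: stable_def distrib_right span_add)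

lemma stable_0: "stable t e 0"
  by (simp add: stable_def span_0)

lemma stable_1: "stable t e 1"
  by (simp add: stable_def span_base)

lemma stable_smult: "stable t e u \<Longrightarrow> stable t e (smult (poly (\<kappa> p) t) u)"
  by (simp add: stable_def span_smult)

lemma stable_sum: "(\<And>i. i \<in> A \<Longrightarrow> stable t e (f i)) \<Longrightarrow> stable t e (sum f A)"
  by (induction A rule: infinite_finite_induct) (auto intro: stable_add stable_0)

lemma stable_imp_integral:
  assumes "e 0 = 1" "stable t e u"
  shows "u \<in> integral_closure_mod P (poly_ring_in t)"
  using assms(1) n_pos
proof (rule in_integral_closure_mod_if_stable)
  show "\<exists>c. [u * e i = (\<Sum>j<n. smult (poly (\<kappa> (c j)) t) (e j))] (mod P)" if "i < n" for i
    using assms(2) that by (simp add: stable_def span_def)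
qed

lemma monom_n_cong: "[monom 1 n = [:fun_x - fun_const a:]] (mod P)"
proof -
  have "monom 1 n - [:fun_x - fun_const a:] = P"
    by (rule poly_eqI)
      (simp add: P_eq D_def fun_const_poly.hom_add map_poly_monom coeff_pCons split: nat.split)
  then show ?thesis
    by (simp add: cong_iff_dvd_diff)
qed

text \<open>The K[x]-module generated by 1, Y, ..., Y^(n-1) is stable under Y because Y^n = x - a,
  hence under every polynomial in Y.\<close>

lemma kappa_integral: "\<kappa> r \<in> integral_closure_mod P (poly_ring_in fun_x)"
proof (rule stable_imp_integral)
  define e :: "nat \<Rightarrow> 'a poly fract poly" where "e = monom 1"
  show "monom 1 0 = (1 :: 'a poly fract poly)"
    by simp
  have Y: "stable fun_x e (monom 1 1)"
    unfolding stable_def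
  proof (intro allI impI)
    fix j assume j: "j < n"
    show "monom 1 1 * e j \<in> span fun_x e"
    proof (cases "Suc j = n")
      case True
      \<comment> \<open>Only the last generator leaves the list: its product with Y is Y^n, a
        multiple of \<open>e 0\<close>.\<close>
      have "poly (\<kappa> [:- a, 1:]) fun_x = fun_x - fun_const a"
        by (simp add: fun_const.hom_uminus)
      then have "[:fun_x - fun_const a:] = smult (poly (\<kappa> [:- a, 1:]) fun_x) (e 0)"
        by (simp add: e_def)
      then show ?thesis
        using span_cong[OF monom_n_cong] span_smult[OF span_base[OF n_pos]] True
        by (metis e_def mult_monom plus_1_eq_Suc mult_1)
    next
      case False
      then have "Suc j < n"
        using j by simp
      then show ?thesis
        using span_base[of "Suc j" e fun_x] by (simp add: e_def mult_monom)
    qed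
  qed
  have "stable fun_x e (\<kappa> r)"
  proof (induction r)
    case (pCons c r)
    have "stable fun_x e (smult (poly (\<kappa> [:c:]) fun_x) 1 + monom 1 1 * \<kappa> r)"
      by (intro stable_add stable_smult stable_1 stable_mult Y pCons.IH)
    then show ?case
      by (simp add: monom_altdef)
  qed (simp add: stable_0)
  then show "stable fun_x (monom 1) (\<kappa> r)"
    by (simp add: e_def)
qed

text \<open>At infinity x has a pole of order n in terms of Y, so Y^i / x^k has none for i at most n
  k. Algebraically, the K[1/x]-module generated by 1, Y/x, ..., Y^(n-1)/x is stable under Y^i/x for
  i at most n, since Y^n/x = 1 - a/x; the general case is a product of \<open>k\<close> such
  factors.\<close>

lemma kappa_div_power_integral:
  assumes "degree s \<le> n * k"
  shows "smult (inverse fun_x ^ k) (\<kappa> s) \<in> integral_closure_mod P (poly_ring_in (inverse fun_x))"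
proof -
  define y where "y = inverse (fun_x :: 'a poly fract)"
  define e where "e j = (if j = 0 then 1 else smult y (monom 1 j))" for j
  have yx: "y * fun_x = 1"
    by (simp add: y_def fun_x_def)
  have y: "poly (\<kappa> [:0, 1:]) y = y"
    by simp
  have n_cong: "[smult y (monom 1 n) = [:poly (\<kappa> [:1, - a:]) y:]] (mod P)"
  proof -
    have "[[:y:] * monom 1 n = [:y:] * [:fun_x - fun_const a:]] (mod P)"
      by (rule cong_scalar_left[OF monom_n_cong])
    also have "[:y:] * [:fun_x - fun_const a:] = [:poly (\<kappa> [:1, - a:]) y:]"
      using yx by (simp add: fun_const.hom_uminus algebra_simps)
    finally show ?thesis
      by simp
  qed
  have below: "smult y (monom 1 l) \<in> span y e" if "l < n" for l
  proof (cases "l = 0")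
    case True
    have "smult (poly (\<kappa> [:0, 1:]) y) (e 0) \<in> span y e"
      by (rule span_smult[OF span_base[OF n_pos]])
    then show ?thesis
      using True by (simp add: e_def)
  next
    case False
    then show ?thesis
      using span_base[OF that, of e y] by (simp add: e_def)
  qed
  have generator: "stable y e (smult y (monom 1 i))" if i: "i \<le> n" for i
    unfolding stable_def
  proof (intro allI impI)
    fix j assume j: "j < n"
    \<comment> \<open>For \<open>j > 0\<close> the product carries a second factor \<open>y\<close>.
      Below exponent \<open>n\<close> this is a coefficient from K[1/x]; from \<open>n\<close> on,
      one \<open>y\<close> is absorbed together with Y^n by \<open>n_cong\<close>.\<close>
    consider "i + j < n" "j = 0" | "i + j < n" "j > 0" | "i + j \<ge> n"
      by linarith
    then show "smult y (monom 1 i) * e j \<in> span y e"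
    proof cases
      case 1
      then show ?thesis
        using below by (simp add: e_def)
    next
      case 2
      then have "smult (poly (\<kappa> [:0, 1:]) y) (smult y (monom 1 (i + j))) \<in> span y e"
        by (intro span_smult below)
      then show ?thesis
        using 2 by (simp add: e_def mult_monom)
    next
      case 3
      define l where "l = i + j - n"
      have l: "i + j = n + l" "l < n"
        using i j 3 by (auto simp: l_def)
      have tail: "[smult y (monom 1 n) * z = smult (poly (\<kappa> [:1, - a:]) y) z] (mod P)" for z
        using cong_scalar_right[OF n_cong, of z] by simp
      show ?thesis
      proof (cases "j = 0")
        case True
        have "smult y (monom 1 n) * e 0 \<in> span y e"
          by (rule span_cong[OF tail span_smult[OF span_base[OF n_pos]]])
        moreover have "i = n"
          using True i 3 by simp
        ultimately show ?thesis
          using True by (simp add: e_def)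
      next
        case False
        have "smult y (monom 1 n) * smult y (monom 1 l) \<in> span y e"
          by (rule span_cong[OF tail span_smult[OF below[OF l(2)]]])
        then show ?thesis
          using False l(1) by (simp add: e_def mult_monom)
      qed
    qed
  qed
  have power: "stable y e (smult (y ^ k) (monom 1 i))" if "i \<le> n * k" for i k
    using that
  proof (induction k arbitrary: i)
    case 0
    then show ?case
      by (simp add: stable_1)
  next
    case (Suc k)
    \<comment> \<open>One factor takes as much of the exponent as it can, at most \<open>n\<close>,
      which leaves at most \<open>n * k\<close> for the others.\<close>
    have "stable y e (smult y (monom 1 (min i n)) * smult (y ^ k) (monom 1 (i - min i n)))"
      using Suc.prems by (intro stable_mult generator Suc.IH) auto
    then show ?case
      by (simp add: mult_monom mult.commute)
  qed
  have "\<kappa> s = (\<Sum>i\<le>degree s. monom (fun_const (coeff s i)) i)"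
    using poly_as_sum_of_monoms[of "\<kappa> s"] by (simp add: fun_const.degree_map_poly_hom)
  then have "smult (y ^ k) (\<kappa> s) =
      smult (y ^ k) (\<Sum>i\<le>degree s. monom (fun_const (coeff s i)) i)"
    by (rule arg_cong)
  also have "\<dots> =
      (\<Sum>i\<le>degree s. smult (poly (\<kappa> [:coeff s i:]) y) (smult (y ^ k) (monom 1 i)))"
    by (simp add: smult_sum2 smult_monom mult.commute)
  also have "stable y e \<dots>"
    using assms by (intro stable_sum stable_smult power) auto
  finally have "stable y e (smult (y ^ k) (\<kappa> s))" .
  moreover have "e 0 = 1"
    by (simp add: e_def)
  ultimately have "smult (y ^ k) (\<kappa> s) \<in> integral_closure_mod P (poly_ring_in y)"
    by (intro stable_imp_integral)
  then show ?thesis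
    by (simp only: y_def)
qed

lemma laurent_integral_decomposition:
  assumes "u \<in> integral_closure_mod P laurent_ring"
  obtains a0 a1 where "u = a0 + a1"
    "a0 \<in> integral_closure_mod P (poly_ring_in fun_x)"
    "a1 \<in> integral_closure_mod P (poly_ring_in (inverse fun_x))"
proof -
  obtain k g where kg: "[\<kappa> (D ^ k) * u = \<kappa> g] (mod P)"
    using assms by (rule integral_imp_denominator_power)
  define r where "r = g div D ^ k"
  define s where "s = g mod D ^ k"
  have g: "g = D ^ k * r + s"
    by (simp add: r_def s_def)
  \<comment> \<open>The weak bound covers \<open>k = 0\<close> as well, where both degrees are
    0.\<close>
  have "degree s \<le> degree (D ^ k)"
    using degree_mod_less'[of "D ^ k" g] D_nonzero by (cases "s = 0") (auto simp: s_def)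
  then have deg: "degree s \<le> n * k"
    by (simp add: degree_power_eq D_nonzero degree_D mult.commute)
  \<comment> \<open>Defined as the exact difference, so that \<open>u = a0 + a1\<close> is an
    equation; \<open>a1\<close> is merely congruent to the remainder divided by x^k.\<close>
  define a1 where "a1 = u - \<kappa> r"
  have "[\<kappa> (D ^ k) * u - \<kappa> (D ^ k) * \<kappa> r = \<kappa> g - \<kappa> (D ^ k) * \<kappa> r] (mod P)"
    by (rule cong_diff[OF kg cong_refl])
  also have "\<kappa> g - \<kappa> (D ^ k) * \<kappa> r = \<kappa> s"
    by (simp only: g fun_const_poly.hom_add fun_const_poly.hom_mult) simp
  finally have "[\<kappa> (D ^ k) * a1 = \<kappa> s] (mod P)"
    by (simp add: a1_def right_diff_distrib)
  moreover have "[\<kappa> (D ^ k) * a1 = [:fun_x:] ^ k * a1] (mod P)"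
    unfolding fun_const_poly.hom_power by (rule cong_scalar_right[OF cong_pow[OF cong_fun_x]])
  ultimately have "[[:fun_x:] ^ k * a1 = \<kappa> s] (mod P)"
    using cong_sym cong_trans by blast
  then have "[[:inverse fun_x ^ k:] * ([:fun_x:] ^ k * a1) = [:inverse fun_x ^ k:] * \<kappa> s] (mod P)"
    by (rule cong_scalar_left)
  moreover have "[:inverse fun_x ^ k:] * ([:fun_x:] ^ k * a1) = a1"
    by (simp add: poly_const_pow fun_x_def flip: power_mult_distrib)
  ultimately have "[a1 = smult (inverse fun_x ^ k) (\<kappa> s)] (mod P)"
    by simp
  then have "a1 \<in> integral_closure_mod P (poly_ring_in (inverse fun_x))"
    using kappa_div_power_integral[OF deg] integral_closure_mod_cong by blast
  then show ?thesis
    using that[of "\<kappa> r" a1] kappa_integral by (simp add: a1_def)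
qed

end

text \<open>The decomposition makes the Cech group vanish. Any element of an independent set would
  already lie in \<open>W\<close>, and the coefficient family that is 1 at this element and 0
  elsewhere contradicts independence.\<close>

lemma curve_genus_linear:
  assumes "n > 0"
  shows "curve_genus n [:- a, 1:] = 0"
proof -
  interpret line_cover n a
    by unfold_locales (rule assms)
  define W where "W = {a0 + a1 | a0 a1. a0 \<in> integral_closure_mod P (poly_ring_in fun_x) \<and>
    a1 \<in> integral_closure_mod P (poly_ring_in (inverse fun_x))}"
  have "U = {}" if U: "finite U" "U \<subseteq> integral_closure_mod P laurent_ring" "independent_mod W U" for U
  proof (rule ccontr)
    assume "U \<noteq> {}"
    then obtain u where u: "u \<in> U"
      by blast
    then have "u \<in> W"
      using laurent_integral_decomposition U(2) unfolding W_def by blast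
    define c where "c w = (if w = u then 1 else 0 :: 'a)" for w
    have "(\<Sum>w\<in>U. smult (fun_const (c w)) w) = (\<Sum>w\<in>U. if w = u then w else 0)"
      by (intro sum.cong) (auto simp: c_def)
    also have "\<dots> = u"
      using U(1) u by simp
    finally have "c u = 0"
      using U(3) \<open>u \<in> W\<close> u unfolding independent_mod_def by metis
    then show False
      by (simp add: c_def)
  qed
  then have "curve_genus n [:- a, 1:] \<le> 0"
    unfolding curve_genus_def Let_def P_def[symmetric] W_def[symmetric]
    by (intro SUP_least) (auto simp: zero_enat_def)
  then show ?thesis
    by simp
qed

section \<open>Moebius transformations and triples\<close>

lemma moebius_compose:
  assumes "\<alpha> * \<delta> - \<beta> * \<gamma> \<noteq> 0" "\<alpha>' * \<delta>' - \<beta>' * \<gamma>' \<noteq> 0"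
  shows "moebius \<alpha> \<beta> \<gamma> \<delta> \<circ> moebius \<alpha>' \<beta>' \<gamma>' \<delta>' =
    moebius (\<alpha> * \<alpha>' + \<beta> * \<gamma>') (\<alpha> * \<beta>' + \<beta> * \<delta>') (\<gamma> * \<alpha>' + \<delta> * \<gamma>') (\<gamma> * \<beta>' + \<delta> * \<delta>')"
proof
  fix z
  show "(moebius \<alpha> \<beta> \<gamma> \<delta> \<circ> moebius \<alpha>' \<beta>' \<gamma>' \<delta>') z =
    moebius (\<alpha> * \<alpha>' + \<beta> * \<gamma>') (\<alpha> * \<beta>' + \<beta> * \<delta>') (\<gamma> * \<alpha>' + \<delta> * \<gamma>') (\<gamma> * \<beta>' + \<delta> * \<delta>') z"
  proof (cases z)
    case (Aff x)
    define A where "A = \<alpha>' * x + \<beta>'"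
    define B where "B = \<gamma>' * x + \<delta>'"
    have num: "(\<alpha> * \<alpha>' + \<beta> * \<gamma>') * x + (\<alpha> * \<beta>' + \<beta> * \<delta>') = \<alpha> * A + \<beta> * B"
      and den: "(\<gamma> * \<alpha>' + \<delta> * \<gamma>') * x + (\<gamma> * \<beta>' + \<delta> * \<delta>') = \<gamma> * A + \<delta> * B"
      by (simp_all add: A_def B_def algebra_simps)
    \<comment> \<open>At a pole of the inner map the outer one takes its value at
      \<open>Infty\<close>. This agrees with the product formula only if \<open>A\<close> does not
      vanish too, which the determinant guarantees.\<close>
    have "A \<noteq> 0" if "B = 0"
    proof
      assume "A = 0"
      have "(\<alpha>' * \<delta>' - \<beta>' * \<gamma>') * x = \<delta>' * A - \<beta>' * B" "\<alpha>' * \<delta>' - \<beta>' * \<gamma>' = \<alpha>' * B - \<gamma>' * A"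
        by (simp_all add: A_def B_def algebra_simps)
      with that \<open>A = 0\<close> assms(2) show False
        by simp
    qed
    moreover have "\<gamma> * (A / B) + \<delta> = (\<gamma> * A + \<delta> * B) / B" "\<alpha> * (A / B) + \<beta> = (\<alpha> * A + \<beta> * B) / B"
      if "B \<noteq> 0"
      using that by (simp_all add: field_simps)
    ultimately show ?thesis
      unfolding Aff comp_apply moebius.simps num den A_def[symmetric] B_def[symmetric]
      by (cases "B = 0") (simp_all del: times_divide_eq_right)
  next
    case Infty
    show ?thesis
    proof (cases "\<gamma>' = 0")
      case True
      with assms(2) have "\<alpha>' \<noteq> 0"
        by auto
      with True show ?thesis
        by (simp add: Infty)
    next
      case False
      then have "\<gamma> * (\<alpha>' / \<gamma>') + \<delta> = (\<gamma> * \<alpha>' + \<delta> * \<gamma>') / \<gamma>'" "\<alpha> * (\<alpha>' / \<gamma>') + \<beta> = (\<alpha> * \<alpha>' + \<beta> * \<gamma>') / \<gamma>'"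
        by (simp_all add: field_simps)
      with False show ?thesis
        by (simp add: Infty del: times_divide_eq_right)
    qed
  qed
qed

lemma moebius_eqI:
  assumes "c \<noteq> 0" "\<alpha>' = c * \<alpha>" "\<beta>' = c * \<beta>" "\<gamma>' = c * \<gamma>" "\<delta>' = c * \<delta>"
  shows "moebius \<alpha>' \<beta>' \<gamma>' \<delta>' = moebius \<alpha> \<beta> \<gamma> \<delta>"
proof
  fix z
  show "moebius \<alpha>' \<beta>' \<gamma>' \<delta>' z = moebius \<alpha> \<beta> \<gamma> \<delta> z"
  proof (cases z)
    case (Aff x)
    have "\<gamma>' * x + \<delta>' = c * (\<gamma> * x + \<delta>)" "\<alpha>' * x + \<beta>' = c * (\<alpha> * x + \<beta>)"
      using assms by (simp_all add: algebra_simps)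
    with assms(1) Aff show ?thesis
      by simp
  qed (use assms in simp)
qed

lemma moebius_id: "moebius 1 0 0 1 = id"
proof
  show "moebius 1 0 0 1 z = id z" for z
    by (cases z) auto
qed

lemma moebius_inverse:
  assumes "\<alpha> * \<delta> - \<beta> * \<gamma> \<noteq> 0"
  shows "moebius \<alpha> \<beta> \<gamma> \<delta> \<circ> moebius \<delta> (- \<beta>) (- \<gamma>) \<alpha> = id"
    and "moebius \<delta> (- \<beta>) (- \<gamma>) \<alpha> \<circ> moebius \<alpha> \<beta> \<gamma> \<delta> = id"
proof -
  have det: "\<delta> * \<alpha> - (- \<beta>) * (- \<gamma>) \<noteq> 0"
    using assms by (simp add: mult.commute)
  show "moebius \<alpha> \<beta> \<gamma> \<delta> \<circ> moebius \<delta> (- \<beta>) (- \<gamma>) \<alpha> = id"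
    unfolding moebius_compose[OF assms det] moebius_id[symmetric]
    by (rule moebius_eqI[OF assms]) (simp_all add: algebra_simps)
  show "moebius \<delta> (- \<beta>) (- \<gamma>) \<alpha> \<circ> moebius \<alpha> \<beta> \<gamma> \<delta> = id"
    unfolding moebius_compose[OF det assms] moebius_id[symmetric]
    by (rule moebius_eqI[OF assms]) (simp_all add: algebra_simps)
qed

lemma bij_moebius:
  assumes "\<alpha> * \<delta> - \<beta> * \<gamma> \<noteq> 0"
  shows "bij (moebius \<alpha> \<beta> \<gamma> \<delta>)"
  using moebius_inverse[OF assms] by (metis o_bij)

lemma inv_moebius:
  assumes "\<alpha> * \<delta> - \<beta> * \<gamma> \<noteq> 0"
  shows "inv_into UNIV (moebius \<alpha> \<beta> \<gamma> \<delta>) = moebius \<delta> (- \<beta>) (- \<gamma>) \<alpha>"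
  using moebius_inverse[OF assms] by (metis inv_unique_comp)

lemma triple_map_moebius:
  assumes "x \<noteq> y" "x \<noteq> z" "y \<noteq> z"
  obtains \<alpha> \<beta> \<gamma> \<delta> where "triple_map (x, y, z) = moebius \<alpha> \<beta> \<gamma> \<delta>" "\<alpha> * \<delta> - \<beta> * \<gamma> \<noteq> 0"
proof (cases "(x, y, z)" rule: triple_map.cases)
  case (1 a b c)
  have "(b - c) * (- ((b - a) * c)) - (- ((b - c) * a)) * (b - a) = (b - c) * (b - a) * (a - c)"
    by (simp add: algebra_simps)
  also have "\<dots> \<noteq> 0"
    using assms 1 by auto
  finally show ?thesis
    using that 1 by auto
qed (use assms that in \<open>auto 0 4 intro: that\<close>)

lemma bij_triple_map:
  assumes "t \<in> triples S"
  shows "bij (triple_map t)"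
proof -
  obtain x y z where t: "t = (x, y, z)" "x \<noteq> y" "x \<noteq> z" "y \<noteq> z"
    using assms by (auto simp: triples_def)
  obtain \<alpha> \<beta> \<gamma> \<delta> where "triple_map t = moebius \<alpha> \<beta> \<gamma> \<delta>" "\<alpha> * \<delta> - \<beta> * \<gamma> \<noteq> 0"
    using triple_map_moebius[OF t(2-4)] t(1) by metis
  then show ?thesis
    by (simp add: bij_moebius)
qed

text \<open>The transformation z -> 1 - z exchanges 0 and 1 and fixes infinity.\<close>

lemma triple_map_swap12:
  assumes "x \<noteq> y" "x \<noteq> z" "y \<noteq> z"
  shows "triple_map (y, x, z) = moebius (- 1) 1 0 1 \<circ> triple_map (x, y, z)"
proof -
  have det: "- 1 * 1 - 1 * 0 \<noteq> (0 :: 'a)"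
    by simp
  have comp: "moebius (- 1) 1 0 1 \<circ> moebius \<alpha> \<beta> \<gamma> \<delta> = moebius (\<gamma> - \<alpha>) (\<delta> - \<beta>) \<gamma> \<delta>"
    if "\<alpha> * \<delta> - \<beta> * \<gamma> \<noteq> 0" for \<alpha> \<beta> \<gamma> \<delta> :: 'a
    using moebius_compose[OF det that] by simp
  show ?thesis
  proof (cases "(x, y, z)" rule: triple_map.cases)
    case (1 a b c)
    have "(b - c) * (- ((b - a) * c)) - (- ((b - c) * a)) * (b - a) = (b - c) * (b - a) * (a - c)"
      by (simp add: algebra_simps)
    also have "\<dots> \<noteq> 0"
      using assms 1 by auto
    finally show ?thesis
      using 1 by (auto simp: comp algebra_simps intro!: moebius_eqI[of "- 1"])
  next
    case (2 b c)
    then show ?thesis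
      using assms by (auto simp: comp)
  next
    case (3 a c)
    then show ?thesis
      using assms by (auto simp: comp)
  next
    case (4 a b)
    then show ?thesis
      using assms by (auto simp: comp intro!: moebius_eqI[of "- 1"])
  qed (use assms in auto)
qed

text \<open>The transformation z -> z / (z - 1) exchanges 1 and infinity and fixes 0.\<close>

lemma triple_map_swap23:
  assumes "x \<noteq> y" "x \<noteq> z" "y \<noteq> z"
  shows "triple_map (x, z, y) = moebius 1 0 1 (- 1) \<circ> triple_map (x, y, z)"
proof -
  have det: "1 * - 1 - 0 * 1 \<noteq> (0 :: 'a)"
    by simp
  have comp: "moebius 1 0 1 (- 1) \<circ> moebius \<alpha> \<beta> \<gamma> \<delta> = moebius \<alpha> \<beta> (\<alpha> - \<gamma>) (\<beta> - \<delta>)"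
    if "\<alpha> * \<delta> - \<beta> * \<gamma> \<noteq> 0" for \<alpha> \<beta> \<gamma> \<delta> :: 'a
    using moebius_compose[OF det that] by simp
  show ?thesis
  proof (cases "(x, y, z)" rule: triple_map.cases)
    case (1 a b c)
    have "(b - c) * (- ((b - a) * c)) - (- ((b - c) * a)) * (b - a) = (b - c) * (b - a) * (a - c)"
      by (simp add: algebra_simps)
    also have "\<dots> \<noteq> 0"
      using assms 1 by auto
    finally show ?thesis
      using 1 by (auto simp: comp algebra_simps intro!: moebius_eqI[of "- 1"])
  next
    case (2 b c)
    then show ?thesis
      using assms by (auto simp: comp intro!: moebius_eqI[of "- 1"])
  next
    case (3 a c)
    then show ?thesis
      using assms by (auto simp: comp)
  next
    case (4 a b)
    then show ?thesis
      using assms by (auto simp: comp)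
  qed (use assms in auto)
qed

section \<open>Ultrametric inequalities and integral Moebius transformations\<close>

locale valued_field =
  fixes v :: "'a::field \<Rightarrow> ereal"
  assumes valuation: "valuation v"
begin

lemma v_mult: "v (x * y) = v x + v y"
  and v_eq_infinity_iff: "v x = \<infinity> \<longleftrightarrow> x = 0"
  and v_not_minus_infinity: "v x \<noteq> - \<infinity>"
  and v_add_ge: "min (v x) (v y) \<le> v (x + y)"
  using valuation by (auto simp: valuation_def)

lemma v_0 [simp]: "v 0 = \<infinity>"
  by (simp add: v_eq_infinity_iff)

lemma v_real: "x \<noteq> 0 \<Longrightarrow> \<exists>r. v x = ereal r"
  using v_eq_infinity_iff[of x] v_not_minus_infinity[of x] by (cases "v x") auto

lemma v_1 [simp]: "v 1 = 0"
  using v_mult[of 1 1] v_real[of 1] by (auto simp: zero_ereal_def)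

lemma v_minus [simp]: "v (- x) = v x"
proof -
  have "v (- 1) = 0"
    using v_mult[of "- 1" "- 1"] v_real[of "- 1"] by (auto simp: zero_ereal_def)
  then show ?thesis
    using v_mult[of "- 1" x] by simp
qed

lemma v_diff_commute: "v (x - y) = v (y - x)"
  using v_minus[of "x - y"] by simp

lemma v_divide: "y \<noteq> 0 \<Longrightarrow> v x = v (x / y) + v y"
  using v_mult[of "x / y" y] by simp

lemma v_ultrametric: "min (v (x - y)) (v (y - z)) \<le> v (x - z)"
  using v_add_ge[of "x - y" "y - z"] by simp

lemma v_diff_ge: "d \<le> v (x - y) \<Longrightarrow> d \<le> v (y - z) \<Longrightarrow> d \<le> v (x - z)"
  using v_ultrametric[of x y z] by (auto simp: min_def split: if_splits)

text \<open>Ultrametric triangles are isosceles, the least valuation of a side occurring twice. This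
  is what makes a triple with distant last entry ordered.\<close>

lemma v_isosceles:
  assumes "v (a - c) < v (a - b)"
  shows "v (b - c) = v (a - c)"
proof (rule antisym)
  show "v (a - c) \<le> v (b - c)"
    using v_diff_ge[of "v (a - c)" b a c] assms v_diff_commute[of a b] by auto
  show "v (b - c) \<le> v (a - c)"
    using v_ultrametric[of a b c] assms by (auto simp: min_def split: if_splits)
qed

lemma integral_moebiusI:
  assumes "0 \<le> v \<alpha>" "0 \<le> v \<beta>" "0 \<le> v \<gamma>" "0 \<le> v \<delta>" "v (\<alpha> * \<delta> - \<beta> * \<gamma>) = 0"
  shows "integral_moebius v (moebius \<alpha> \<beta> \<gamma> \<delta>)"
  using assms by (auto simp: integral_moebius_def valuation_ring_def)

lemma integral_moebiusE:
  assumes "integral_moebius v g"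
  obtains \<alpha> \<beta> \<gamma> \<delta> where "g = moebius \<alpha> \<beta> \<gamma> \<delta>" "0 \<le> v \<alpha>" "0 \<le> v \<beta>" "0 \<le> v \<gamma>" "0 \<le> v \<delta>"
    "v (\<alpha> * \<delta> - \<beta> * \<gamma>) = 0" "\<alpha> * \<delta> - \<beta> * \<gamma> \<noteq> 0"
proof -
  obtain \<alpha> \<beta> \<gamma> \<delta> where m: "g = moebius \<alpha> \<beta> \<gamma> \<delta>" "0 \<le> v \<alpha>" "0 \<le> v \<beta>" "0 \<le> v \<gamma>" "0 \<le> v \<delta>"
    "v (\<alpha> * \<delta> - \<beta> * \<gamma>) = 0"
    using assms by (auto simp: integral_moebius_def valuation_ring_def)
  moreover have "\<alpha> * \<delta> - \<beta> * \<gamma> \<noteq> 0"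
    using m(6) v_eq_infinity_iff[of "\<alpha> * \<delta> - \<beta> * \<gamma>"] by auto
  ultimately show ?thesis
    using that by blast
qed

lemma integral_id: "integral_moebius v id"
  unfolding moebius_id[symmetric] by (rule integral_moebiusI) auto

lemma v_sum_products_nonneg:
  "0 \<le> v a \<Longrightarrow> 0 \<le> v b \<Longrightarrow> 0 \<le> v c \<Longrightarrow> 0 \<le> v d \<Longrightarrow> 0 \<le> v (a * b + c * d)"
  using v_add_ge[of "a * b" "c * d"] by (auto simp: v_mult min_def split: if_splits
      intro: order_trans[OF add_nonneg_nonneg])

lemma integral_comp:
  assumes "integral_moebius v g" "integral_moebius v h"
  shows "integral_moebius v (g \<circ> h)"
proof -
  obtain \<alpha> \<beta> \<gamma> \<delta> where g: "g = moebius \<alpha> \<beta> \<gamma> \<delta>" "0 \<le> v \<alpha>" "0 \<le> v \<beta>" "0 \<le> v \<gamma>" "0 \<le> v \<delta>"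
    "v (\<alpha> * \<delta> - \<beta> * \<gamma>) = 0" "\<alpha> * \<delta> - \<beta> * \<gamma> \<noteq> 0"
    using assms(1) by (rule integral_moebiusE)
  obtain \<alpha>' \<beta>' \<gamma>' \<delta>' where h: "h = moebius \<alpha>' \<beta>' \<gamma>' \<delta>'" "0 \<le> v \<alpha>'" "0 \<le> v \<beta>'" "0 \<le> v \<gamma>'" "0 \<le> v \<delta>'"
    "v (\<alpha>' * \<delta>' - \<beta>' * \<gamma>') = 0" "\<alpha>' * \<delta>' - \<beta>' * \<gamma>' \<noteq> 0"
    using assms(2) by (rule integral_moebiusE)
  have det: "(\<alpha> * \<alpha>' + \<beta> * \<gamma>') * (\<gamma> * \<beta>' + \<delta> * \<delta>') - (\<alpha> * \<beta>' + \<beta> * \<delta>') * (\<gamma> * \<alpha>' + \<delta> * \<gamma>') =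
      (\<alpha> * \<delta> - \<beta> * \<gamma>) * (\<alpha>' * \<delta>' - \<beta>' * \<gamma>')"
    by (simp add: algebra_simps)
  show ?thesis
    unfolding g(1) h(1) moebius_compose[OF g(7) h(7)]
    by (rule integral_moebiusI) (simp_all only: det v_mult g h v_sum_products_nonneg add_0)
qed

lemma integral_inv:
  assumes "integral_moebius v g"
  shows "integral_moebius v (inv_into UNIV g)" and "bij g"
proof -
  obtain \<alpha> \<beta> \<gamma> \<delta> where g: "g = moebius \<alpha> \<beta> \<gamma> \<delta>" "0 \<le> v \<alpha>" "0 \<le> v \<beta>" "0 \<le> v \<gamma>" "0 \<le> v \<delta>"
    "v (\<alpha> * \<delta> - \<beta> * \<gamma>) = 0" "\<alpha> * \<delta> - \<beta> * \<gamma> \<noteq> 0"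
    using assms by (rule integral_moebiusE)
  show "integral_moebius v (inv_into UNIV g)"
    unfolding g(1) inv_moebius[OF g(7)]
    by (rule integral_moebiusI) (use g in \<open>simp_all add: mult.commute\<close>)
  show "bij g"
    unfolding g(1) by (rule bij_moebius[OF g(7)])
qed

text \<open>An affine map determines its matrix up to a scalar, so integrality can be read off.\<close>

lemma integral_affine_iff:
  assumes "p \<noteq> 0" "r \<noteq> 0"
  shows "integral_moebius v (moebius p q 0 r) \<longleftrightarrow> v p = v r \<and> v r \<le> v q"
proof
  assume "integral_moebius v (moebius p q 0 r)"
  then obtain \<alpha> \<beta> \<gamma> \<delta> where m: "moebius p q 0 r = moebius \<alpha> \<beta> \<gamma> \<delta>"
    "0 \<le> v \<alpha>" "0 \<le> v \<beta>" "0 \<le> v \<gamma>" "0 \<le> v \<delta>" "v (\<alpha> * \<delta> - \<beta> * \<gamma>) = 0" "\<alpha> * \<delta> - \<beta> * \<gamma> \<noteq> 0"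
    by (rule integral_moebiusE)
  have \<gamma>: "\<gamma> = 0"
    using fun_cong[OF m(1), of Infty] by (auto split: if_splits)
  then have nz: "\<alpha> \<noteq> 0" "\<delta> \<noteq> 0"
    using m(7) by auto
  obtain x y where xy: "v \<alpha> = ereal x" "v \<delta> = ereal y"
    using v_real nz by blast
  \<comment> \<open>Two nonnegative valuations with sum 0 both vanish.\<close>
  then have unit: "v \<alpha> = 0" "v \<delta> = 0"
    using m(2,5,6) \<gamma> by (auto simp: v_mult zero_ereal_def)
  \<comment> \<open>The values at 0 and 1 determine an affine map, hence both matrices up to a
    common factor.\<close>
  have 0: "q / r = \<beta> / \<delta>" and 1: "(p + q) / r = (\<alpha> + \<beta>) / \<delta>"
    using fun_cong[OF m(1), of "Aff 0"] fun_cong[OF m(1), of "Aff 1"] assms nz \<gamma> by auto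
  then have "p / r = \<alpha> / \<delta>"
    by (simp add: add_divide_distrib)
  then have "p * \<delta> = \<alpha> * r" "q * \<delta> = \<beta> * r"
    using 0 assms nz by (simp_all add: field_simps)
  then have "v p + v \<delta> = v \<alpha> + v r" "v q + v \<delta> = v \<beta> + v r"
    by (metis v_mult)+
  then show "v p = v r \<and> v r \<le> v q"
    using unit m(3) by (auto simp: add_increasing)
next
  assume *: "v p = v r \<and> v r \<le> v q"
  obtain s where s: "v r = ereal s"
    using v_real assms(2) by blast
  have "v (p / r) = 0" "0 \<le> v (q / r)"
    using v_divide[OF assms(2), of p] v_divide[OF assms(2), of q] * s
    by (cases "v (p / r)"; cases "v (q / r)"; auto simp: zero_ereal_def)+
  then have "integral_moebius v (moebius (p / r) (q / r) 0 1)"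
    by (intro integral_moebiusI) auto
  also have "moebius (p / r) (q / r) 0 1 = moebius p q 0 r"
    using assms by (intro moebius_eqI[of "1 / r"]) auto
  finally show "integral_moebius v (moebius p q 0 r)" .
qed

section \<open>Equivalence of triples and ordered representatives\<close>

lemma equiv_triple_equiv: "equiv (triples S) (triple_equiv v S)"
proof (rule equivI)
  show "triple_equiv v S \<subseteq> triples S \<times> triples S"
    by (auto simp: triple_equiv_def)
  show "refl_on (triples S) (triple_equiv v S)"
  proof (rule refl_onI)
    fix t assume t: "t \<in> triples S"
    then have "triple_map t \<circ> inv_into UNIV (triple_map t) = id"
      unfolding surj_iff[symmetric] by (rule bij_is_surj[OF bij_triple_map])
    then show "(t, t) \<in> triple_equiv v S"
      using t by (simp add: triple_equiv_def integral_id)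
  qed
  show "sym (triple_equiv v S)"
  proof (rule symI)
    fix s t assume st: "(s, t) \<in> triple_equiv v S"
    then have bij: "bij (triple_map s)" "bij (triple_map t)"
      by (auto simp: triple_equiv_def intro: bij_triple_map)
    have "inv_into UNIV (triple_map t \<circ> inv_into UNIV (triple_map s)) =
        triple_map s \<circ> inv_into UNIV (triple_map t)"
      using bij by (subst o_inv_distrib) (auto simp: bij_imp_bij_inv inv_inv_eq)
    then show "(t, s) \<in> triple_equiv v S"
      using st integral_inv(1) unfolding triple_equiv_def by fastforce
  qed
  show "trans (triple_equiv v S)"
  proof (rule transI)
    fix s t u assume st: "(s, t) \<in> triple_equiv v S" and tu: "(t, u) \<in> triple_equiv v S"
    then have "bij (triple_map t)"
      by (auto simp: triple_equiv_def intro: bij_triple_map)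
    then have "(triple_map u \<circ> inv_into UNIV (triple_map t)) \<circ>
        (triple_map t \<circ> inv_into UNIV (triple_map s)) = triple_map u \<circ> inv_into UNIV (triple_map s)"
      by (auto simp: fun_eq_iff bij_is_inj)
    then show "(s, u) \<in> triple_equiv v S"
      using st tu integral_comp unfolding triple_equiv_def by fastforce
  qed
qed

lemma triple_equivI:
  assumes "s \<in> triples S" "t \<in> triples S" "triple_map t = g \<circ> triple_map s" "integral_moebius v g"
  shows "(s, t) \<in> triple_equiv v S"
proof -
  have "triple_map t \<circ> inv_into UNIV (triple_map s) = g"
    using bij_triple_map[OF assms(1)] by (simp add: assms(3) fun_eq_iff bij_is_surj surj_f_inv_f)
  then show ?thesis
    using assms by (simp add: triple_equiv_def)
qed

lemma triple_equiv_swap12: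
  assumes "(x, y, z) \<in> triples S"
  shows "((x, y, z), (y, x, z)) \<in> triple_equiv v S"
  using assms
  by (intro triple_equivI[OF _ _ triple_map_swap12]) (auto simp: triples_def intro!: integral_moebiusI)

lemma triple_equiv_swap23:
  assumes "(x, y, z) \<in> triples S"
  shows "((x, y, z), (x, z, y)) \<in> triple_equiv v S"
  using assms
  by (intro triple_equivI[OF _ _ triple_map_swap23]) (auto simp: triples_def intro!: integral_moebiusI)

text \<open>The last entry should be \<open>Infty\<close> if it occurs, and otherwise the vertex
  common to two sides of least valuation. Being ordered is symmetric in the first two entries, so
  three arrangements suffice, and transpositions reach them.\<close>

lemma ex_ordered_triple:
  assumes "t \<in> triples S"
  obtains t' where "(t, t') \<in> triple_equiv v S" "ordered_triple v t'"
proof -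
  define E where "E = triple_equiv v S"
  have refl: "(t, t) \<in> E" if "t \<in> triples S" for t
    using that equiv_triple_equiv unfolding E_def equiv_def refl_on_def by blast
  have trans: "(r, t) \<in> E" if "(r, s) \<in> E" "(s, t) \<in> E" for r s t
    using that equiv_triple_equiv unfolding E_def equiv_def trans_def by blast
  obtain x y z where t: "t = (x, y, z)"
    by (cases t)
  have xyz: "(x, y, z) \<in> triples S" "(y, x, z) \<in> triples S" "(x, z, y) \<in> triples S"
    using assms by (auto simp: t triples_def)
  have swaps: "(t, (x, y, z)) \<in> E" "(t, (x, z, y)) \<in> E" "(t, (y, z, x)) \<in> E"
    using refl[OF xyz(1)] triple_equiv_swap23[OF xyz(1)]
      trans[OF triple_equiv_swap12[OF xyz(1), folded E_def] triple_equiv_swap23[OF xyz(2), folded E_def]]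
    by (simp_all add: t E_def)
  have "ordered_triple v (x, y, z) \<or> ordered_triple v (x, z, y) \<or> ordered_triple v (y, z, x)"
  proof (cases "x = Infty \<or> y = Infty \<or> z = Infty")
    case True
    have "vdiff v p Infty = - \<infinity>" "vdiff v Infty p = - \<infinity>" for p
      by (cases p; simp)+
    with True show ?thesis
      by auto
  next
    case False
    then obtain a b c where abc: "x = Aff a" "y = Aff b" "z = Aff c"
      by (metis pline.exhaust)
    consider "v (a - c) < v (a - b)" | "v (a - b) < v (a - c)" | "v (a - b) = v (a - c)"
      by fastforce
    then show ?thesis
    proof cases
      case 1
      then show ?thesis
        using v_isosceles[OF 1] less_imp_le[OF 1] by (simp add: abc)
    next
      case 2
      then show ?thesis
        using v_isosceles[OF 2] less_imp_le[OF 2] v_diff_commute[of b c] by (simp add: abc)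
    next
      case 3
      then show ?thesis
        using v_diff_ge[of "v (a - b)" b a c] v_diff_commute[of a b] v_diff_commute[of a c]
        by (simp add: abc)
    qed
  qed
  then show ?thesis
    using that swaps unfolding E_def by blast
qed

lemma ordered_triple_affine:
  assumes "t \<in> triples S" "ordered_triple v t"
  obtains a b z g where "t = (Aff a, Aff b, z)" "a \<noteq> b" "integral_moebius v g"
    "triple_map t = g \<circ> moebius 1 (- a) 0 (b - a)"
proof -
  obtain x y z where t: "t = (x, y, z)"
    by (cases t)
  have dist: "x \<noteq> y" "x \<noteq> z" "y \<noteq> z"
    using assms(1) by (auto simp: t triples_def)
  \<comment> \<open>An infinite first or second entry would give the difference of the two finite
    entries the valuation -\<infinity>.\<close>
  have "x \<noteq> Infty" "y \<noteq> Infty"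
    using assms(2) dist v_not_minus_infinity by (cases x; cases y; cases z; auto simp: t)+
  then obtain a b where ab: "x = Aff a" "y = Aff b"
    by (metis pline.exhaust)
  have "a \<noteq> b"
    using dist ab by auto
  show ?thesis
  proof (cases z)
    case Infty
    then have "triple_map t = id \<circ> moebius 1 (- a) 0 (b - a)"
      by (simp add: t ab)
    then show ?thesis
      using that \<open>a \<noteq> b\<close> integral_id by (simp add: t ab)
  next
    case (Aff c)
    have ac: "a - c \<noteq> 0" and bc: "b - c \<noteq> 0" and ba: "b - a \<noteq> 0"
      using dist by (auto simp: ab Aff)
    have ord: "v (a - c) = v (b - c)" "v (b - c) \<le> v (a - b)"
      using assms(2) by (simp_all add: t ab Aff)
    obtain s where s: "v (b - c) = ereal s"
      using v_real bc by blast
    have v1: "0 \<le> v ((b - a) / (b - c))" and v2: "v ((a - c) / (b - c)) = 0"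
      using v_divide[OF bc, of "b - a"] v_divide[OF bc, of "a - c"] ord s v_diff_commute[of a b]
      by (cases "v ((b - a) / (b - c))"; cases "v ((a - c) / (b - c))"; auto simp: zero_ereal_def)+
    \<comment> \<open>This \<open>g\<close> fixes 0 and 1 and sends
      \<open>(c - a) / (b - a)\<close>, the affine image of \<open>c\<close>, to infinity. The order
      condition makes its entries integral and its determinant \<open>(a - c) / (b - c)\<close> a
      unit.\<close>
    define g where "g = moebius 1 0 ((b - a) / (b - c)) ((a - c) / (b - c))"
    have "integral_moebius v g"
      unfolding g_def using v1 v2 by (intro integral_moebiusI) auto
    moreover have "triple_map t = g \<circ> moebius 1 (- a) 0 (b - a)"
    proof -
      have det: "1 * ((a - c) / (b - c)) - 0 * ((b - a) / (b - c)) \<noteq> 0" "1 * (b - a) - (- a) * 0 \<noteq> 0"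
        using ac bc ba by auto
      show ?thesis
        unfolding g_def moebius_compose[OF det] t ab Aff triple_map.simps
      proof (rule moebius_eqI[OF bc])
        have "(b - a) / (b - c) * (- a) + (a - c) / (b - c) * (b - a) =
            ((b - a) * (- a) + (a - c) * (b - a)) / (b - c)"
          by (simp only: times_divide_eq_left add_divide_distrib)
        also have "(b - a) * (- a) + (a - c) * (b - a) = - ((b - a) * c)"
          by (simp add: algebra_simps)
        finally show "- ((b - a) * c) =
            (b - c) * ((b - a) / (b - c) * (- a) + (a - c) / (b - c) * (b - a))"
          using bc by simp
      qed (use bc in simp_all)
    qed
    ultimately show ?thesis
      using that \<open>a \<noteq> b\<close> by (simp add: t ab)
  qed
qed

text \<open>Integral factors on either side do not affect integrality, so both maps may be replaced
  by their affine parts \<open>L\<close> and \<open>L'\<close>. The transition map \<open>M\<close>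
  is then affine and \<open>integral_affine_iff\<close> applies.\<close>

lemma ordered_triples_equiv_iff:
  assumes "(Aff a, Aff b, z) \<in> triples S" "ordered_triple v (Aff a, Aff b, z)"
    and "(Aff a', Aff b', z') \<in> triples S" "ordered_triple v (Aff a', Aff b', z')"
  shows "((Aff a, Aff b, z), (Aff a', Aff b', z')) \<in> triple_equiv v S \<longleftrightarrow>
    v (a - b) = v (a' - b') \<and> v (a' - b') \<le> v (a - a')"
proof -
  obtain g where g: "a \<noteq> b" "integral_moebius v g"
      "triple_map (Aff a, Aff b, z) = g \<circ> moebius 1 (- a) 0 (b - a)"
    using assms(1,2) by (rule ordered_triple_affine) simp
  obtain g' where g': "a' \<noteq> b'" "integral_moebius v g'"
      "triple_map (Aff a', Aff b', z') = g' \<circ> moebius 1 (- a') 0 (b' - a')"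
    using assms(3,4) by (rule ordered_triple_affine) simp
  define L where "L = moebius 1 (- a) 0 (b - a)"
  define L' where "L' = moebius 1 (- a') 0 (b' - a')"
  define M where "M = L' \<circ> inv_into UNIV L"
  have det: "1 * (b - a) - (- a) * 0 \<noteq> 0" "1 * (b' - a') - (- a') * 0 \<noteq> 0"
      "(b - a) * 1 - (- (- a)) * (- 0) \<noteq> 0"
    using g(1) g'(1) by auto
  have M: "M = moebius (b - a) (a - a') 0 (b' - a')"
    unfolding M_def L'_def L_def inv_moebius[OF det(1)] moebius_compose[OF det(2,3)] by simp
  have bij: "bij g" "bij g'" "bij L"
    using g(2) g'(2) integral_inv(2) bij_moebius[OF det(1)] by (auto simp: L_def)
  define N where "N = triple_map (Aff a', Aff b', z') \<circ> inv_into UNIV (triple_map (Aff a, Aff b, z))"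
  have N: "N = g' \<circ> M \<circ> inv_into UNIV g"
    unfolding N_def g(3) g'(3) L_def[symmetric] L'_def[symmetric] M_def
    using bij by (simp add: o_inv_distrib o_assoc)
  have "M = inv_into UNIV g' \<circ> N \<circ> g"
    unfolding N using bij by (auto simp: fun_eq_iff bij_is_inj)
  then have "integral_moebius v N \<longleftrightarrow> integral_moebius v M"
    using N g(2) g'(2) integral_inv(1) integral_comp by metis
  also have "\<dots> \<longleftrightarrow> v (b - a) = v (b' - a') \<and> v (b' - a') \<le> v (a - a')"
    unfolding M using g(1) g'(1) by (intro integral_affine_iff) auto
  finally show ?thesis
    using assms unfolding triple_equiv_def N_def
    by (simp add: v_diff_commute[of b a] v_diff_commute[of b' a'])
qed

end

section \<open>Clusters and their children\<close>

locale valued_roots = valued_field v for v :: "'a::field \<Rightarrow> ereal" +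
  fixes w :: "'a alg_closure \<Rightarrow> ereal" and R :: "'a set" and S :: "'a pline set"
  assumes discrete: "discrete_valuation v"
    and w: "valuation w" and w_to_ac: "\<And>x. w (to_ac x) = v x"
    and finite_R: "finite R"
    and S: "Aff ` R \<subseteq> S" "S \<subseteq> insert Infty (Aff ` R)"
begin

abbreviation E :: "('a triple \<times> 'a triple) set" where "E \<equiv> triple_equiv v S"

abbreviation \<Phi> :: "'a triple set \<Rightarrow> 'a set" where "\<Phi> \<equiv> class_cluster v w R"

text \<open>The trace on the roots of a disc centred in the base field, written with
  \<open>v\<close> so that the algebraic closure can be left aside.\<close>

definition ball :: "'a \<Rightarrow> ereal \<Rightarrow> 'a set" where
  "ball a \<mu> = {x \<in> R. \<mu> \<le> v (x - a)}"

lemma v_int: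
  assumes "x \<noteq> 0"
  obtains m :: int where "v x = ereal (of_int m)"
proof -
  have "v x \<in> range (\<lambda>m::int. ereal (of_int m))"
    using discrete assms unfolding discrete_valuation_def by blast
  then show ?thesis
    using that by blast
qed

lemma mem_disc_to_ac: "to_ac x \<in> disc w (to_ac a) d \<longleftrightarrow> d \<le> v (x - a)"
  by (simp add: disc_def flip: w_to_ac)

lemma triple_cluster_eq: "triple_cluster v w R (Aff a, Aff b, z) = ball a (v (a - b))"
  by (simp add: mem_disc_to_ac ball_def)

lemma cluster_ball:
  assumes "a \<in> R"
  shows "cluster w R (ball a (ereal (of_int m)))"
proof -
  have "ball a (ereal (of_int m)) = {x \<in> R. to_ac x \<in> disc w (to_ac a) (ereal (of_rat (of_int m)))}"
    by (simp add: ball_def mem_disc_to_ac)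
  moreover have "a \<in> ball a (ereal (of_int m))"
    using assms by (simp add: ball_def)
  ultimately show ?thesis
    unfolding cluster_def by blast
qed

text \<open>A disc containing \<open>a\<close> and \<open>b\<close> contains everything as close to
  \<open>a\<close> as \<open>b\<close> is, by the ultrametric inequality. Its centre may lie outside
  the base field, so the estimate is made with \<open>w\<close>.\<close>

lemma cluster_absorbs:
  assumes "cluster w R s" "a \<in> s" "b \<in> s" "x \<in> R" "v (a - b) \<le> v (x - a)"
  shows "x \<in> s"
proof -
  interpret w: valued_field w
    by unfold_locales (rule w)
  obtain z d where s: "s = {x \<in> R. to_ac x \<in> disc w z (ereal (of_rat d))}"
    using assms(1) unfolding cluster_def by blast
  define e where "e = ereal (real_of_rat d)"
  have a: "e \<le> w (to_ac a - z)" and b: "e \<le> w (to_ac b - z)"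
    using assms(2,3) by (auto simp: s disc_def e_def)
  then have "e \<le> w (to_ac a - to_ac b)"
    using w.v_diff_ge[of e "to_ac a" z "to_ac b"] w.v_diff_commute[of z "to_ac b"] by simp
  also have "\<dots> = v (a - b)"
    by (simp only: w_to_ac flip: to_ac_diff)
  also have "\<dots> \<le> v (x - a)"
    by (rule assms(5))
  also have "\<dots> = w (to_ac x - to_ac a)"
    by (simp only: w_to_ac flip: to_ac_diff)
  finally have "e \<le> w (to_ac x - z)"
    using a by (rule w.v_diff_ge)
  then show ?thesis
    using assms(4) by (simp add: s disc_def e_def)
qed

section \<open>The induced map from classes of triples to clusters, and its injectivity\<close>

lemma ordered_tripleE:
  assumes "t \<in> triples S" "ordered_triple v t"
  obtains a b z where "t = (Aff a, Aff b, z)" "a \<in> R" "b \<in> R" "a \<noteq> b"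
    "triple_cluster v w R t = ball a (v (a - b))"
proof -
  obtain a b z where t: "t = (Aff a, Aff b, z)" "a \<noteq> b"
    using assms by (rule ordered_triple_affine)
  then have "Aff a \<in> S" "Aff b \<in> S"
    using assms(1) by (auto simp: triples_def)
  then have "a \<in> R" "b \<in> R"
    using S(2) by auto
  then show ?thesis
    using that t triple_cluster_eq by blast
qed

text \<open>The radius is attained inside the ball, by the difference of its two defining roots, so
  equal balls have equal radii; conversely every point of a disc is a centre of it.\<close>

lemma ball_eq_iff:
  assumes "a \<in> R" "b \<in> R" "a' \<in> R" "b' \<in> R"
  shows "ball a (v (a - b)) = ball a' (v (a' - b')) \<longleftrightarrow>
    v (a - b) = v (a' - b') \<and> v (a' - b') \<le> v (a - a')"
proof
  have mem: "a \<in> ball a (v (a - b))" "b \<in> ball a (v (a - b))"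
      "a' \<in> ball a' (v (a' - b'))" "b' \<in> ball a' (v (a' - b'))"
    using assms v_diff_commute by (auto simp: ball_def)
  have close: "d \<le> v (x - y)" if "x \<in> ball c d" "y \<in> ball c d" for x y c d
    using that v_diff_commute by (intro v_diff_ge[of d x c y]) (auto simp: ball_def)
  assume eq: "ball a (v (a - b)) = ball a' (v (a' - b'))"
  then have "v (a' - b') \<le> v (a - b)" "v (a - b) \<le> v (a' - b')"
    using mem close by blast+
  then show "v (a - b) = v (a' - b') \<and> v (a' - b') \<le> v (a - a')"
    using mem close eq by (auto intro: antisym)
next
  assume *: "v (a - b) = v (a' - b') \<and> v (a' - b') \<le> v (a - a')"
  have "ball a d \<subseteq> ball a' d" if "d \<le> v (a - a')" for a a' d
    using that v_diff_ge by (auto simp: ball_def)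
  then show "ball a (v (a - b)) = ball a' (v (a' - b'))"
    using * v_diff_commute[of a a'] by (intro equalityI) auto
qed

text \<open>Both sides amount to the same condition on radii and centres. One direction makes the
  map on classes well defined, the other makes it injective.\<close>

lemma equiv_iff_same_cluster:
  assumes "t \<in> triples S" "ordered_triple v t" "t' \<in> triples S" "ordered_triple v t'"
  shows "(t, t') \<in> E \<longleftrightarrow> triple_cluster v w R t = triple_cluster v w R t'"
proof -
  obtain a b z where t: "t = (Aff a, Aff b, z)" "a \<in> R" "b \<in> R" "a \<noteq> b"
    "triple_cluster v w R t = ball a (v (a - b))"
    using assms(1,2) by (rule ordered_tripleE)
  obtain a' b' z' where t': "t' = (Aff a', Aff b', z')" "a' \<in> R" "b' \<in> R" "a' \<noteq> b'"
    "triple_cluster v w R t' = ball a' (v (a' - b'))"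
    using assms(3,4) by (rule ordered_tripleE)
  show ?thesis
    unfolding t(5) t'(5) ball_eq_iff[OF t(2,3) t'(2,3)]
    using ordered_triples_equiv_iff assms unfolding t(1) t'(1) by blast
qed

lemma class_cluster_eq:
  assumes "t \<in> triples S" "ordered_triple v t"
  shows "\<Phi> (E `` {t}) = triple_cluster v w R t"
proof -
  have "triple_cluster v w R ` {t' \<in> E `` {t}. ordered_triple v t'} = {triple_cluster v w R t}"
  proof (intro equalityI subsetI)
    fix c assume "c \<in> triple_cluster v w R ` {t' \<in> E `` {t}. ordered_triple v t'}"
    then obtain t' where t': "c = triple_cluster v w R t'" "(t, t') \<in> E" "ordered_triple v t'"
      by blast
    then have "t' \<in> triples S"
      by (simp add: triple_equiv_def)
    then show "c \<in> {triple_cluster v w R t}"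
      using t' equiv_iff_same_cluster assms by simp
  next
    fix c assume "c \<in> {triple_cluster v w R t}"
    moreover have "(t, t) \<in> E"
      using equiv_iff_same_cluster assms by simp
    ultimately show "c \<in> triple_cluster v w R ` {t' \<in> E `` {t}. ordered_triple v t'}"
      using assms(2) by blast
  qed
  then show ?thesis
    by (simp add: class_cluster_def)
qed

lemma quotient_ordered:
  assumes "C \<in> triples S // E"
  obtains t where "t \<in> triples S" "ordered_triple v t" "C = E `` {t}" "t \<in> C"
proof -
  obtain s where s: "s \<in> triples S" "C = E `` {s}"
    using assms by (rule quotientE)
  obtain t where t: "(s, t) \<in> E" "ordered_triple v t"
    using s(1) by (rule ex_ordered_triple)
  moreover have "t \<in> triples S"
    using t(1) by (simp add: triple_equiv_def)
  moreover have "E `` {s} = E `` {t}"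
    using equiv_class_eq[OF equiv_triple_equiv t(1)] .
  ultimately show ?thesis
    using that s(2) by blast
qed

lemma inj_on_class_cluster: "inj_on \<Phi> (triples S // E)"
proof (rule inj_onI)
  fix C C' assume C: "C \<in> triples S // E" "C' \<in> triples S // E" and eq: "\<Phi> C = \<Phi> C'"
  obtain t where t: "t \<in> triples S" "ordered_triple v t" "C = E `` {t}"
    using C(1) by (rule quotient_ordered)
  obtain t' where t': "t' \<in> triples S" "ordered_triple v t'" "C' = E `` {t'}"
    using C(2) by (rule quotient_ordered)
  have "(t, t') \<in> E"
    using eq t t' by (simp add: class_cluster_eq equiv_iff_same_cluster)
  then show "C = C'"
    unfolding t(3) t'(3) by (rule equiv_class_eq[OF equiv_triple_equiv])
qed

lemma proper_cluster_triple_cluster: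
  assumes "t \<in> triples S" "ordered_triple v t"
  shows "triple_cluster v w R t \<in> proper_clusters w R"
proof -
  obtain a b z where t: "a \<in> R" "b \<in> R" "a \<noteq> b" "triple_cluster v w R t = ball a (v (a - b))"
    using assms by (rule ordered_tripleE)
  \<comment> \<open>Discreteness makes the radius an integer, hence rational as the discs of
    clusters require.\<close>
  have "cluster w R (ball a (v (a - b)))"
    using v_int[of "a - b"] cluster_ball[OF t(1)] t(3) by (metis right_minus_eq)
  moreover have "{a, b} \<subseteq> ball a (v (a - b))"
    using t(1,2) v_diff_commute by (auto simp: ball_def)
  then have "card {a, b} \<le> card (ball a (v (a - b)))"
    by (rule card_mono[rotated]) (simp add: ball_def finite_R)
  ultimately show ?thesis
    using t(3,4) by (simp add: proper_clusters_def)
qed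

section \<open>Clusters in the image\<close>

lemma triple_cluster_in_image:
  assumes "t \<in> triples S" "ordered_triple v t"
  shows "triple_cluster v w R t \<in> \<Phi> ` (triples S // E)"
  using class_cluster_eq[OF assms] quotientI[OF assms(1), of E] by (metis imageI)

text \<open>Minimising \<open>v (x - a)\<close> selects a point farthest from \<open>a\<close>,
  which gives the smallest disc around \<open>a\<close> containing \<open>s\<close>. The point
  \<open>a\<close> is excluded from the minimum but satisfies the bound, as
  \<open>v 0 = \<infinity>\<close>.\<close>

lemma ex_closest:
  assumes "finite s" "a \<in> s" "card s > 1"
  obtains b where "b \<in> s" "b \<noteq> a" "\<forall>x\<in>s. v (a - b) \<le> v (x - a)"
proof -
  have "s - {a} \<noteq> {}"
    using assms by (metis card.empty card_Diff_singleton diff_is_0_eq leD)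
  then have "Min ((\<lambda>x. v (x - a)) ` (s - {a})) \<in> (\<lambda>x. v (x - a)) ` (s - {a})"
    using assms(1) by (intro Min_in) auto
  then obtain b where b: "b \<in> s - {a}" "Min ((\<lambda>x. v (x - a)) ` (s - {a})) = v (b - a)"
    by blast
  have "v (a - b) \<le> v (x - a)" if "x \<in> s" for x
  proof (cases "x = a")
    case False
    then show ?thesis
      using that assms(1) unfolding v_diff_commute[of a b] b(2)[symmetric] by (intro Min_le) auto
  qed simp
  then show ?thesis
    using that b(1) by blast
qed

text \<open>Any element \<open>a\<close> serves as centre, and a farthest element fixes the radius;
  \<open>cluster_absorbs\<close> shows that no other root lies in that ball.\<close>

lemma proper_cluster_conv_ball:
  assumes "s \<in> proper_clusters w R"
  obtains a b where "a \<in> s" "b \<in> s" "a \<noteq> b" "s = ball a (v (a - b))"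
proof -
  have s: "cluster w R s" "card s > 1" "s \<subseteq> R"
    using assms by (auto simp: proper_clusters_def cluster_def)
  then obtain a where a: "a \<in> s"
    by (metis card.empty ex_in_conv not_less_zero)
  obtain b where b: "b \<in> s" "b \<noteq> a" "\<forall>x\<in>s. v (a - b) \<le> v (x - a)"
    using finite_subset[OF s(3) finite_R] a s(2) by (rule ex_closest)
  have "s = ball a (v (a - b))"
    using b(3) s(3) cluster_absorbs[OF s(1) a b(1)] by (auto simp: ball_def)
  then show ?thesis
    using that a b(1,2) by metis
qed

text \<open>A root \<open>c\<close> outside the cluster completes the triple: it is farther from
  \<open>a\<close> than \<open>b\<close> is, so \<open>v_isosceles\<close> gives the order
  condition.\<close>

lemma proper_clusters_in_image: "proper_clusters w R - {R} \<subseteq> \<Phi> ` (triples S // E)"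
proof
  fix s assume s: "s \<in> proper_clusters w R - {R}"
  then obtain a b where ab: "a \<in> s" "b \<in> s" "a \<noteq> b" "s = ball a (v (a - b))"
    using proper_cluster_conv_ball by blast
  have "s \<subseteq> R"
    unfolding ab(4) by (auto simp: ball_def)
  then obtain c where c: "c \<in> R" "c \<notin> s"
    using s by blast
  then have less: "v (a - c) < v (a - b)"
    using ab(4) v_diff_commute[of c a] by (auto simp: ball_def)
  define t :: "'a triple" where "t = (Aff a, Aff b, Aff c)"
  have "t \<in> triples S"
    using ab(1-3) c S(1) \<open>s \<subseteq> R\<close> by (auto simp: t_def triples_def)
  moreover have "ordered_triple v t"
    using v_isosceles[OF less] less by (simp add: t_def)
  moreover have "triple_cluster v w R t = s"
    using triple_cluster_eq ab(4) by (simp add: t_def)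
  ultimately show "s \<in> \<Phi> ` (triples S // E)"
    using triple_cluster_in_image by metis
qed

text \<open>With \<open>Infty\<close> as last entry every pair of roots gives an ordered triple; a
  root farthest from \<open>a\<close> makes the radius small enough to capture all of
  \<open>R\<close>.\<close>

lemma R_in_image_if_infty:
  assumes "Infty \<in> S" "card R > 1"
  shows "R \<in> \<Phi> ` (triples S // E)"
proof -
  obtain a where a: "a \<in> R"
    using assms(2) by (metis card.empty ex_in_conv not_less_zero)
  obtain b where b: "b \<in> R" "b \<noteq> a" "\<forall>x\<in>R. v (a - b) \<le> v (x - a)"
    using finite_R a assms(2) by (rule ex_closest)
  define t :: "'a triple" where "t = (Aff a, Aff b, Infty)"
  have "t \<in> triples S"
    using a b(1,2) assms(1) S(1) by (auto simp: t_def triples_def)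
  moreover have "ordered_triple v t"
    by (simp add: t_def)
  moreover have "triple_cluster v w R t = R"
    unfolding t_def triple_cluster_eq using b(3) by (auto simp: ball_def)
  ultimately show ?thesis
    using triple_cluster_in_image by metis
qed

section \<open>The maximal cluster: equidistant roots and children\<close>

definition equidistant :: "'a \<Rightarrow> 'a \<Rightarrow> 'a \<Rightarrow> bool" where
  "equidistant a b c \<longleftrightarrow> a \<noteq> b \<and> a \<noteq> c \<and> b \<noteq> c \<and>
    diameter v R = v (a - b) \<and> v (a - b) = v (b - c) \<and> v (b - c) = v (a - c)"

lemma finite_differences: "finite {v (z - t) | z t. z \<in> R \<and> t \<in> R}"
proof -
  have "{v (z - t) | z t. z \<in> R \<and> t \<in> R} = (\<lambda>(z, t). v (z - t)) ` (R \<times> R)"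
    by auto
  then show ?thesis
    using finite_R by simp
qed

lemma diameter_le: "x \<in> R \<Longrightarrow> y \<in> R \<Longrightarrow> diameter v R \<le> v (x - y)"
  unfolding diameter_def by (rule Min_le[OF finite_differences]) blast

lemma diameter_attained:
  assumes "R \<noteq> {}"
  obtains x y where "x \<in> R" "y \<in> R" "diameter v R = v (x - y)"
proof -
  have "diameter v R \<in> {v (z - t) | z t. z \<in> R \<and> t \<in> R}"
    unfolding diameter_def using assms by (intro Min_in finite_differences) auto
  then show ?thesis
    using that by blast
qed

lemma R_in_image_if_equidistant:
  assumes "a \<in> R" "b \<in> R" "c \<in> R" "equidistant a b c"
  shows "R \<in> \<Phi> ` (triples S // E)"
proof -
  define t :: "'a triple" where "t = (Aff a, Aff b, Aff c)"
  have "t \<in> triples S"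
    using assms S(1) by (auto simp: t_def triples_def equidistant_def)
  moreover have "ordered_triple v t"
    using assms(4) by (simp add: t_def equidistant_def)
  moreover have "triple_cluster v w R t = R"
    unfolding t_def triple_cluster_eq using assms diameter_le
    by (auto simp: ball_def equidistant_def)
  ultimately show ?thesis
    using triple_cluster_in_image by metis
qed

text \<open>The strict inequality yields the next smaller disc inside the maximal cluster; these
  sets turn out to be its children.\<close>

definition open_ball :: "'a \<Rightarrow> 'a set" where
  "open_ball a = {x \<in> R. diameter v R < v (x - a)}"

lemma diameter_int:
  assumes "card R > 1"
  obtains m :: int where "diameter v R = ereal (of_int m)"
proof -
  obtain a where a: "a \<in> R"
    using assms by (metis card.empty ex_in_conv not_less_zero)
  obtain b where b: "b \<in> R" "b \<noteq> a"
    using finite_R a assms by (rule ex_closest)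
  obtain x y where xy: "x \<in> R" "y \<in> R" "diameter v R = v (x - y)"
    using a diameter_attained by blast
  \<comment> \<open>The set minimised in \<open>diameter\<close> includes the value \<infinity> from
    \<open>z = t\<close>. It is not the minimum, because two distinct roots give a finite
    value.\<close>
  have "x \<noteq> y"
  proof
    assume "x = y"
    then show False
      using diameter_le[OF a b(1)] b(2) xy(3) v_eq_infinity_iff[of "a - b"] by simp
  qed
  then show ?thesis
    using that xy(3) v_int[of "x - y"] by (metis right_minus_eq)
qed

lemma mem_open_ball:
  assumes "a \<in> R" "card R > 1"
  shows "a \<in> open_ball a"
proof -
  obtain m :: int where "diameter v R = ereal (of_int m)"
    using assms(2) by (rule diameter_int)
  then show ?thesis
    using assms(1) by (simp add: open_ball_def)
qed

lemma open_ball_eq_iff: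
  assumes "a \<in> R" "b \<in> R" "card R > 1"
  shows "open_ball a = open_ball b \<longleftrightarrow> diameter v R < v (a - b)"
proof
  assume "open_ball a = open_ball b"
  then show "diameter v R < v (a - b)"
    using mem_open_ball[OF assms(1,3)] by (simp add: open_ball_def)
next
  have sub: "open_ball a \<subseteq> open_ball b" if "diameter v R < v (a - b)" for a b
  proof
    fix x assume "x \<in> open_ball a"
    then have x: "x \<in> R" "diameter v R < min (v (x - a)) (v (a - b))"
      using that by (auto simp: open_ball_def)
    have "diameter v R < v (x - b)"
      using x(2) v_ultrametric by (rule less_le_trans)
    with x(1) show "x \<in> open_ball b"
      by (simp add: open_ball_def)
  qed
  assume "diameter v R < v (a - b)"
  then show "open_ball a = open_ball b"
    using sub[of a b] sub[of b a] v_diff_commute[of a b] by simp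
qed

text \<open>Valuations of nonzero elements are integers, so exceeding \<open>m\<close> means being
  at least \<open>m + 1\<close>, and the strict ball is a closed one.\<close>

lemma cluster_open_ball:
  assumes "a \<in> R" "card R > 1"
  shows "cluster w R (open_ball a)"
proof -
  obtain m :: int where m: "diameter v R = ereal (of_int m)"
    using assms(2) by (rule diameter_int)
  have "open_ball a = ball a (ereal (of_int (m + 1)))"
  proof -
    have "diameter v R < v x \<longleftrightarrow> ereal (of_int (m + 1)) \<le> v x" for x
    proof (cases "x = 0")
      case False
      then obtain l :: int where "v x = ereal (of_int l)"
        by (rule v_int)
      then show ?thesis
        by (simp add: m) linarith
    qed (simp add: m)
    then show ?thesis
      by (simp add: open_ball_def ball_def)
  qed
  then show ?thesis
    using cluster_ball[OF assms(1), of "m + 1"] by simp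
qed

text \<open>A point \<open>x\<close> of the cluster at maximal distance from \<open>a\<close> would,
  by \<open>cluster_absorbs\<close>, bring all of \<open>R\<close> into it.\<close>

lemma cluster_subset_open_ball:
  assumes "cluster w R s" "s \<subset> R" "a \<in> s"
  shows "s \<subseteq> open_ball a"
proof
  fix x assume x: "x \<in> s"
  show "x \<in> open_ball a"
  proof (rule ccontr)
    assume "x \<notin> open_ball a"
    then have le: "v (a - x) \<le> diameter v R"
      using x assms(2) v_diff_commute[of a x] by (auto simp: open_ball_def)
    have "y \<in> s" if "y \<in> R" for y
    proof (rule cluster_absorbs[OF assms(1,3) x that])
      show "v (a - x) \<le> v (y - a)"
        using le diameter_le[OF that, of a] assms(2,3) by (auto intro: order_trans)
    qed
    then show False
      using assms(2) by blast
  qed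
qed

text \<open>If both roots attaining the diameter were in the open ball, the ultrametric inequality
  would push their difference above it.\<close>

lemma open_ball_psubset:
  assumes "a \<in> R"
  shows "open_ball a \<subset> R"
proof -
  obtain x y where xy: "x \<in> R" "y \<in> R" "diameter v R = v (x - y)"
    using assms diameter_attained by blast
  have "\<not> (diameter v R < v (x - a) \<and> diameter v R < v (y - a))"
    using v_ultrametric[of x a y] v_diff_commute[of a y] xy(3)
    by (auto simp: min_def split: if_splits)
  then have "x \<notin> open_ball a \<or> y \<notin> open_ball a"
    by (auto simp: open_ball_def)
  then show ?thesis
    using xy by (auto simp: open_ball_def)
qed

text \<open>Open balls are clusters properly inside \<open>R\<close>, and every such cluster lies in
  the open ball around each of its points. The maximal ones are therefore exactly the open
  balls.\<close>

lemma children_R: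
  assumes "card R > 1"
  shows "children w R R = open_ball ` R"
proof (intro equalityI subsetI)
  fix s assume "s \<in> children w R R"
  then have s: "cluster w R s" "s \<subset> R"
      "\<And>s'. cluster w R s' \<Longrightarrow> s' \<subset> R \<Longrightarrow> s \<subseteq> s' \<Longrightarrow> s' = s"
    by (auto simp: children_def)
  then obtain a where a: "a \<in> s" "a \<in> R"
    by (auto simp: cluster_def)
  then have "open_ball a = s"
    by (intro s(3) cluster_open_ball open_ball_psubset cluster_subset_open_ball s assms)
  then show "s \<in> open_ball ` R"
    using a by blast
next
  fix s assume "s \<in> open_ball ` R"
  then obtain a where a: "a \<in> R" "s = open_ball a"
    by blast
  have "s' = s" if s': "cluster w R s'" "s' \<subset> R" "s \<subseteq> s'" for s'
    using s' cluster_subset_open_ball[OF s'(1,2)] mem_open_ball[OF a(1) assms] a(2) by blast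
  then show "s \<in> children w R R"
    using cluster_open_ball[OF a(1) assms] open_ball_psubset[OF a(1)] a(2)
    by (auto simp: children_def)
qed

text \<open>Two roots lie in different children exactly when the valuation of their difference
  equals the diameter, so equidistant triples are choices of one root from each of three
  children.\<close>

lemma equidistant_iff_children:
  "(\<exists>a\<in>R. \<exists>b\<in>R. \<exists>c\<in>R. equidistant a b c) \<longleftrightarrow> card (children w R R) > 2"
proof
  assume "\<exists>a\<in>R. \<exists>b\<in>R. \<exists>c\<in>R. equidistant a b c"
  then obtain a b c where abc: "a \<in> R" "b \<in> R" "c \<in> R" "equidistant a b c"
    by blast
  then have "card {a, b} \<le> card R"
    by (intro card_mono finite_R) auto
  moreover have "a \<noteq> b"
    using abc(4) by (simp add: equidistant_def)
  ultimately have R: "card R > 1"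
    by simp
  have "open_ball a \<noteq> open_ball b" "open_ball a \<noteq> open_ball c" "open_ball b \<noteq> open_ball c"
    using abc open_ball_eq_iff[OF _ _ R] by (auto simp: equidistant_def)
  then have "card {open_ball a, open_ball b, open_ball c} = 3"
    by simp
  moreover have "card {open_ball a, open_ball b, open_ball c} \<le> card (open_ball ` R)"
    using abc by (intro card_mono) (auto simp: finite_R)
  ultimately show "card (children w R R) > 2"
    by (simp add: children_R[OF R])
next
  assume card: "card (children w R R) > 2"
  \<comment> \<open>With at most one root the only proper subset of \<open>R\<close> is empty, and
    there would be no children.\<close>
  have R: "card R > 1"
  proof (rule ccontr)
    assume "\<not> card R > 1"
    then have "x = y" if "x \<in> R" "y \<in> R" for x y
      using that card_le_Suc0_iff_eq[OF finite_R] by (simp add: not_less)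
    then have "s = {}" if "s \<subset> R" for s
      using that by blast
    then have "children w R R = {}"
      unfolding children_def cluster_def by blast
    then show False
      using card by simp
  qed
  then have "3 \<le> card (open_ball ` R)"
    using card by (simp add: children_R)
  then obtain T where T: "T \<subseteq> open_ball ` R" "card T = 3"
    by (meson obtain_subset_with_card_n)
  then obtain A B C where "T = {A, B, C}" "A \<noteq> B" "B \<noteq> C" "A \<noteq> C"
    by (auto simp: card_3_iff)
  with T(1) have "A \<in> open_ball ` R" "B \<in> open_ball ` R" "C \<in> open_ball ` R"
    by auto
  then obtain a b c where "a \<in> R" "b \<in> R" "c \<in> R"
      and "A = open_ball a" "B = open_ball b" "C = open_ball c"
    by auto
  with \<open>A \<noteq> B\<close> \<open>B \<noteq> C\<close> \<open>A \<noteq> C\<close> have abc: "a \<in> R" "b \<in> R" "c \<in> R"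
      "open_ball a \<noteq> open_ball b" "open_ball b \<noteq> open_ball c" "open_ball a \<noteq> open_ball c"
    by auto
  have "v (x - y) = diameter v R" if "x \<in> R" "y \<in> R" "open_ball x \<noteq> open_ball y" for x y
    using that diameter_le[OF that(1,2)] open_ball_eq_iff[OF that(1,2) R] by auto
  then have "v (a - b) = diameter v R" "v (b - c) = diameter v R" "v (a - c) = diameter v R"
    using abc by auto
  then have "equidistant a b c"
    using abc(4-6) by (auto simp: equidistant_def)
  then show "\<exists>a\<in>R. \<exists>b\<in>R. \<exists>c\<in>R. equidistant a b c"
    using abc(1-3) by blast
qed

end

section \<open>The roots of a separable split polynomial\<close>

text \<open>Dividing by one linear factor leaves a nonconstant polynomial that again has a root. If
  it were the same root, \<open>f\<close> and its derivative would share a factor and the resultant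
  would vanish.\<close>

lemma card_roots_greater_1:
  fixes f :: "'a::field poly"
  assumes "monic_discriminant f \<noteq> 0" and deg: "degree f > 1"
    and split: "{z. poly (map_poly to_ac f) z = 0} \<subseteq> range (to_ac :: 'a \<Rightarrow> 'a alg_closure)"
  shows "card {x. poly f x = 0} > 1"
proof -
  interpret to_ac: inj_comm_ring_hom "to_ac :: 'a \<Rightarrow> _"
    by unfold_locales auto
  interpret to_ac_poly: map_poly_inj_comm_ring_hom "to_ac :: 'a \<Rightarrow> _" ..
  have res: "resultant f (pderiv f) \<noteq> 0"
    using assms(1) by (simp add: monic_discriminant_def)
  \<comment> \<open>A root of the divisor in the algebraic closure is also a root of
    \<open>f\<close>, hence comes from the base field.\<close>
  have root: "\<exists>a. poly g a = 0" if "degree g > 0" "g dvd f" for g :: "'a poly"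
  proof -
    obtain z where z: "poly (map_poly to_ac g) z = 0"
      using alg_closed_imp_poly_has_root[of "map_poly to_ac g"] \<open>degree g > 0\<close>
      by (auto simp: to_ac.degree_map_poly_hom)
    moreover have "map_poly to_ac g dvd map_poly to_ac f"
      using \<open>g dvd f\<close> by (rule to_ac_poly.hom_dvd)
    ultimately have "poly (map_poly to_ac f) z = 0"
      by (metis dvd_trans poly_eq_0_iff_dvd)
    then obtain a where "z = to_ac a"
      using split by blast
    then show ?thesis
      using z by (metis to_ac.poly_map_poly to_ac_eq_0_iff)
  qed
  obtain a where a: "poly f a = 0"
    using root[of f] deg by auto
  then obtain g where g: "f = [:- a, 1:] * g"
    by (metis dvdE poly_eq_0_iff_dvd)
  have "g dvd f"
    unfolding g by (rule dvd_triv_right)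
  have "g \<noteq> 0"
    using g deg by auto
  then have "degree f = 1 + degree g"
    by (simp add: g degree_mult_eq del: mult_pCons_left)
  then obtain b where b: "poly g b = 0"
    using root[of g] deg \<open>g dvd f\<close> by auto
  have "a \<noteq> b"
  proof
    assume "a = b"
    then have "poly (pderiv f) a = 0"
      using b unfolding g pderiv_mult poly_add poly_mult by simp
    then have "[:- a, 1:] dvd pderiv f"
      unfolding poly_eq_0_iff_dvd .
    moreover have "[:- a, 1:] dvd f"
      using a unfolding poly_eq_0_iff_dvd .
    \<comment> \<open>The common factor is carried to the algebraic closure, where the resultant
      vanishes if the gcd is not constant; \<open>resultant_hom\<close> carries this back.\<close>
    ultimately have "map_poly to_ac [:- a, 1:] dvd gcd (map_poly to_ac f) (map_poly to_ac (pderiv f))"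
      by (intro gcd_greatest to_ac_poly.hom_dvd)
    moreover have "map_poly to_ac f \<noteq> 0"
      using deg by auto
    then have "gcd (map_poly to_ac f) (map_poly to_ac (pderiv f)) \<noteq> 0"
      by (simp only: gcd_eq_0_iff) simp
    ultimately have "degree (map_poly to_ac [:- a, 1:]) \<le>
        degree (gcd (map_poly to_ac f) (map_poly to_ac (pderiv f)))"
      by (rule dvd_imp_degree_le)
    moreover have "degree (map_poly to_ac [:- a, 1:]) = 1"
      by (subst to_ac.degree_map_poly_hom) simp
    ultimately have "resultant (map_poly to_ac f) (map_poly to_ac (pderiv f)) = 0"
      unfolding resultant_0_gcd by linarith
    then show False
      using res by (simp add: to_ac.resultant_hom)
  qed
  then have "card {a, b} = 2"
    by simp
  moreover have "card {a, b} \<le> card {x. poly f x = 0}"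
    using a b deg \<open>g dvd f\<close> by (intro card_mono poly_roots_finite) auto
  ultimately show ?thesis
    by simp
qed

theorem theorem2p6:
  fixes v :: "'k::field \<Rightarrow> ereal"
    and w :: "'k alg_closure \<Rightarrow> ereal"
    and \<pi> :: 'k
    and n p :: nat
    and f :: "'k poly"
    and R :: "'k set"
    and S :: "'k pline set"
    and E :: "('k triple \<times> 'k triple) set"
    and \<Phi> :: "'k triple set \<Rightarrow> 'k set"
  assumes "discrete_valuation v" and "valuation_complete v" and "v \<pi> = 1"
    and "valuation w" and "\<And>x. w (to_ac x) = v x"
    and "p = residue_char v"
    and "n \<ge> 2" and "\<not> p dvd n"
    and "\<exists>\<zeta>::'k. primitive_root_of_unity n \<zeta>"
    and "\<And>i. coeff f i \<in> valuation_ring v" and "lead_coeff f = 1"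
    and "monic_discriminant f \<noteq> 0"
    and "{z. poly (map_poly to_ac f) z = 0} \<subseteq> range (to_ac :: 'k \<Rightarrow> 'k alg_closure)"
    and "curve_genus n f > 0"
    and "R = {x. poly f x = 0}"
    and "S = branch_set n f"
    and "E = triple_equiv v S"
    and "\<Phi> = class_cluster v w R"
  shows "equiv (triples S) E
    \<and> (\<forall>C \<in> triples S // E. \<exists>t \<in> C. ordered_triple v t)
    \<and> (\<forall>t1 t2. (t1, t2) \<in> E \<and> ordered_triple v t1 \<and> ordered_triple v t2 \<longrightarrow>
         triple_cluster v w R t1 = triple_cluster v w R t2)
    \<and> (\<forall>t \<in> triples S. ordered_triple v t \<longrightarrow> \<Phi> (E `` {t}) = triple_cluster v w R t)
    \<and> \<Phi> ` (triples S // E) \<subseteq> proper_clusters w R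
    \<and> inj_on \<Phi> (triples S // E)
    \<and> proper_clusters w R - {R} \<subseteq> \<Phi> ` (triples S // E)
    \<and> (Infty \<in> S \<longrightarrow> R \<in> \<Phi> ` (triples S // E))
    \<and> ((\<exists>a\<in>R. \<exists>b\<in>R. \<exists>c\<in>R. a \<noteq> b \<and> a \<noteq> c \<and> b \<noteq> c \<and>
          diameter v R = v (a - b) \<and> v (a - b) = v (b - c) \<and> v (b - c) = v (a - c)) \<longrightarrow>
        R \<in> \<Phi> ` (triples S // E))
    \<and> ((\<exists>a\<in>R. \<exists>b\<in>R. \<exists>c\<in>R. a \<noteq> b \<and> a \<noteq> c \<and> b \<noteq> c \<and>
          diameter v R = v (a - b) \<and> v (a - b) = v (b - c) \<and> v (b - c) = v (a - c))
        \<longleftrightarrow> card (children w R R) > 2)"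
proof -
  have "f \<noteq> 0"
    using assms(11) by auto
  interpret valued_roots v w R S
  proof unfold_locales
    show "valuation v"
      using assms(1) by (simp add: discrete_valuation_def)
    show "finite R"
      using poly_roots_finite[OF \<open>f \<noteq> 0\<close>] by (simp add: assms(15))
    show "Aff ` R \<subseteq> S" "S \<subseteq> insert Infty (Aff ` R)"
      by (auto simp: assms(15,16) branch_set_def)
  qed (use assms(1,4,5) in auto)
  \<comment> \<open>If \<open>Infty\<close> is in \<open>S\<close>, then \<open>n\<close> does not
    divide the degree, which excludes degree 0, and positive genus excludes degree 1.\<close>
  have card_R: "card R > 1" if "Infty \<in> S"
  proof -
    have "\<not> n dvd degree f"
      using that by (auto simp: assms(16) branch_set_def split: if_splits)
    then have "degree f > 0"
      by (metis dvd_0_right gr0I)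
    moreover have "degree f \<noteq> 1"
    proof
      assume "degree f = 1"
      then have "f = [:- (- coeff f 0), 1:]"
        using assms(11) degree1_coeffs[of f] by force
      then have "curve_genus n f = 0"
        using curve_genus_linear[of n "- coeff f 0"] assms(7) by simp
      then show False
        using assms(14) by simp
    qed
    ultimately show ?thesis
      unfolding assms(15) using assms(12,13) by (intro card_roots_greater_1) auto
  qed
  have E: "E = triple_equiv v S" and \<Phi>: "\<Phi> = class_cluster v w R"
    by (rule assms)+
  have same: "triple_cluster v w R t1 = triple_cluster v w R t2"
    if "(t1, t2) \<in> triple_equiv v S" "ordered_triple v t1" "ordered_triple v t2" for t1 t2
    using that equiv_iff_same_cluster unfolding triple_equiv_def by blast
  have sub: "class_cluster v w R ` (triples S // triple_equiv v S) \<subseteq> proper_clusters w R"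
  proof
    fix c assume "c \<in> class_cluster v w R ` (triples S // triple_equiv v S)"
    then obtain C where C: "C \<in> triples S // triple_equiv v S" "c = class_cluster v w R C"
      by blast
    obtain t where "t \<in> triples S" "ordered_triple v t" "C = triple_equiv v S `` {t}"
      using C(1) by (rule quotient_ordered)
    then show "c \<in> proper_clusters w R"
      using proper_cluster_triple_cluster class_cluster_eq C(2) by simp
  qed
  show ?thesis
    \<comment> \<open>Folds the condition on three roots into \<open>equidistant\<close>.\<close>
    unfolding E \<Phi> equidistant_def[symmetric]
  proof (intro conjI)
    show "equiv (triples S) (triple_equiv v S)"
      by (rule equiv_triple_equiv)
    show "\<forall>C\<in>triples S // triple_equiv v S. \<exists>t\<in>C. ordered_triple v t"
    proof
      fix C assume "C \<in> triples S // triple_equiv v S"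
      then obtain t where "ordered_triple v t" "t \<in> C"
        by (rule quotient_ordered)
      then show "\<exists>t\<in>C. ordered_triple v t" ..
    qed
    show "\<forall>t1 t2. (t1, t2) \<in> triple_equiv v S \<and> ordered_triple v t1 \<and> ordered_triple v t2 \<longrightarrow>
        triple_cluster v w R t1 = triple_cluster v w R t2"
      using same by blast
    show "\<forall>t\<in>triples S. ordered_triple v t \<longrightarrow>
        class_cluster v w R (triple_equiv v S `` {t}) = triple_cluster v w R t"
      using class_cluster_eq by blast
    show "Infty \<in> S \<longrightarrow> R \<in> class_cluster v w R ` (triples S // triple_equiv v S)"
      using R_in_image_if_infty card_R by blast
    show "(\<exists>a\<in>R. \<exists>b\<in>R. \<exists>c\<in>R. equidistant a b c) \<longrightarrow>
        R \<in> class_cluster v w R ` (triples S // triple_equiv v S)"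
      using R_in_image_if_equidistant by blast
  qed (rule sub inj_on_class_cluster proper_clusters_in_image equidistant_iff_children)+
qed

end
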